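(* Let $R$ be a semilocal ring and let $M$ be a finitely generated right $R$-module. Then $M=P\oplus N$ for a projective submodule $P$ and a stable submodule $N$ of $M$.
   Context: Rings are associative with unity, modules are unital. A ring $R$ is semilocal if $R/\operatorname{Jac}(R)$ is a semisimple ring, where $\operatorname{Jac}(R)$ is the Jacobson radical. A module is called stable if it has no nonzero projective direct summand. *)

theory Defs
  imports "HOL-Algebra.Module" "HOL-Algebra.QuotRing"
begin

text \<open>
  The library locale \<open>module\<close> requires a commutative ring, but its record and its predicate
  \<open>submodule\<close> do not.  We reuse both: in a right module, \<open>r \<odot>\<^bsub>M\<^esub> x\<close> (scalar written
  first) stands for the product \<open>x \<cdot> r\<close>, which explains the order of the factors in the
  associativity law.  As for the library's modules, the fields \<open>mult\<close> and \<open>one\<close> inherited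
  from the ring record play no role.
\<close>

locale right_module = R?: ring R + M?: abelian_group M
  for R :: "('a, 'r) ring_scheme" (structure) and M :: "('a, 'b, 'm) module_scheme" (structure) +
  assumes smult_closed [simp, intro]:
      "\<lbrakk> r \<in> carrier R; x \<in> carrier M \<rbrakk> \<Longrightarrow> r \<odot>\<^bsub>M\<^esub> x \<in> carrier M"
    and smult_l_distr:
      "\<lbrakk> r \<in> carrier R; s \<in> carrier R; x \<in> carrier M \<rbrakk> \<Longrightarrow>
       (r \<oplus>\<^bsub>R\<^esub> s) \<odot>\<^bsub>M\<^esub> x = r \<odot>\<^bsub>M\<^esub> x \<oplus>\<^bsub>M\<^esub> s \<odot>\<^bsub>M\<^esub> x"
    and smult_r_distr:
      "\<lbrakk> r \<in> carrier R; x \<in> carrier M; y \<in> carrier M \<rbrakk> \<Longrightarrow>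
       r \<odot>\<^bsub>M\<^esub> (x \<oplus>\<^bsub>M\<^esub> y) = r \<odot>\<^bsub>M\<^esub> x \<oplus>\<^bsub>M\<^esub> r \<odot>\<^bsub>M\<^esub> y"
    and smult_assoc:
      "\<lbrakk> r \<in> carrier R; s \<in> carrier R; x \<in> carrier M \<rbrakk> \<Longrightarrow>
       (r \<otimes>\<^bsub>R\<^esub> s) \<odot>\<^bsub>M\<^esub> x = s \<odot>\<^bsub>M\<^esub> (r \<odot>\<^bsub>M\<^esub> x)"
    and smult_one [simp]:
      "x \<in> carrier M \<Longrightarrow> \<one>\<^bsub>R\<^esub> \<odot>\<^bsub>M\<^esub> x = x"

definition finitely_generated ::
  "('a, 'r) ring_scheme \<Rightarrow> ('a, 'b, 'm) module_scheme \<Rightarrow> bool" where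
  "finitely_generated R M \<longleftrightarrow>
     (\<exists>S. finite S \<and> S \<subseteq> carrier M \<and>
        (\<forall>N. submodule N R M \<and> S \<subseteq> N \<longrightarrow> N = carrier M))"

definition internal_direct_sum ::
  "('a, 'r) ring_scheme \<Rightarrow> ('a, 'b, 'm) module_scheme \<Rightarrow> 'b set \<Rightarrow> 'b set \<Rightarrow> bool" where
  "internal_direct_sum R M P N \<longleftrightarrow>
     submodule P R M \<and> submodule N R M \<and>
     P <+>\<^bsub>M\<^esub> N = carrier M \<and> P \<inter> N = {\<zero>\<^bsub>M\<^esub>}"

definition right_module_hom ::
  "('a, 'r) ring_scheme \<Rightarrow> ('a, 'b, 'm) module_scheme \<Rightarrow> ('a, 'c, 'n) module_scheme
     \<Rightarrow> ('b \<Rightarrow> 'c) set" where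
  "right_module_hom R M N =
     {f \<in> hom (add_monoid M) (add_monoid N).
        \<forall>r\<in>carrier R. \<forall>x\<in>carrier M. f (r \<odot>\<^bsub>M\<^esub> x) = r \<odot>\<^bsub>N\<^esub> f x}"

definition lifting_property ::
  "('a, 'r) ring_scheme \<Rightarrow> ('a, 'p, 'k) module_scheme \<Rightarrow>
   ('a, 'b, 'm) module_scheme \<Rightarrow> ('a, 'c, 'n) module_scheme \<Rightarrow> bool" where
  "lifting_property R P A B \<longleftrightarrow>
     (\<forall>f g. f \<in> right_module_hom R A B \<and> f ` carrier A = carrier B \<and>
            g \<in> right_module_hom R P B \<longrightarrow>
        (\<exists>h \<in> right_module_hom R P A. \<forall>x\<in>carrier P. f (h x) = g x))"

text \<open>
  A definition cannot quantify over all types, so the test modules \<open>A\<close> and \<open>B\<close> live on fixed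
  types: functions from the underlying type of the module to that of the ring (large enough for
  the free module on the carrier of \<open>P\<close>), and the underlying type of the module.  The theorem
  \<open>projective_lifting\<close> below shows that the lifting property then holds for test modules on
  arbitrary types.
\<close>

definition projective_right_module ::
  "('a, 'r) ring_scheme \<Rightarrow> ('a, 'b, 'm) module_scheme \<Rightarrow> bool" where
  "projective_right_module R P \<longleftrightarrow>
     right_module R P \<and>
     (\<forall>(A :: ('a, 'b \<Rightarrow> 'a) module) (B :: ('a, 'b) module).
        right_module R A \<and> right_module R B \<longrightarrow> lifting_property R P A B)"

definition stable_right_module ::
  "('a, 'r) ring_scheme \<Rightarrow> ('a, 'b, 'm) module_scheme \<Rightarrow> bool" where
  "stable_right_module R M \<longleftrightarrow>
     right_module R M \<and>
     \<not> (\<exists>P N. internal_direct_sum R M P N \<and> P \<noteq> {\<zero>\<^bsub>M\<^esub>} \<and>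
              projective_right_module R (M\<lparr>carrier := P\<rparr>))"

definition regular_right_module :: "('a, 'r) ring_scheme \<Rightarrow> ('a, 'a) module" where
  "regular_right_module R =
     \<lparr>carrier = carrier R, mult = mult R, one = one R, zero = zero R, add = add R,
      smult = (\<lambda>r x. x \<otimes>\<^bsub>R\<^esub> r)\<rparr>"

definition right_ideal :: "'a set \<Rightarrow> ('a, 'r) ring_scheme \<Rightarrow> bool" where
  "right_ideal I R \<longleftrightarrow> submodule I R (regular_right_module R)"

definition maximal_right_ideal :: "'a set \<Rightarrow> ('a, 'r) ring_scheme \<Rightarrow> bool" where
  "maximal_right_ideal I R \<longleftrightarrow>
     right_ideal I R \<and> I \<noteq> carrier R \<and>
     (\<forall>J. right_ideal J R \<and> I \<subseteq> J \<longrightarrow> J = I \<or> J = carrier R)"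

text \<open>Intersecting with the carrier matters only for the zero ring, which has no maximal right
  ideals and is its own Jacobson radical.\<close>

definition jacobson_radical :: "('a, 'r) ring_scheme \<Rightarrow> 'a set" where
  "jacobson_radical R = carrier R \<inter> \<Inter>{I. maximal_right_ideal I R}"

definition semisimple_right_module ::
  "('a, 'r) ring_scheme \<Rightarrow> ('a, 'b, 'm) module_scheme \<Rightarrow> bool" where
  "semisimple_right_module R M \<longleftrightarrow>
     right_module R M \<and>
     (\<forall>N. submodule N R M \<longrightarrow> (\<exists>N'. internal_direct_sum R M N N'))"

definition semisimple_ring :: "('a, 'r) ring_scheme \<Rightarrow> bool" where
  "semisimple_ring R \<longleftrightarrow> ring R \<and> semisimple_right_module R (regular_right_module R)"

definition semilocal_ring :: "('a, 'r) ring_scheme \<Rightarrow> bool" where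
  "semilocal_ring R \<longleftrightarrow> ring R \<and> semisimple_ring (R Quot (jacobson_radical R))"


subsection \<open>Independence of projectivity from the types of the test modules\<close>

lemma (in right_module) smult_l_null [simp]:
  assumes "x \<in> carrier M" shows "\<zero>\<^bsub>R\<^esub> \<odot>\<^bsub>M\<^esub> x = \<zero>\<^bsub>M\<^esub>"
proof -
  have "\<zero>\<^bsub>R\<^esub> \<odot>\<^bsub>M\<^esub> x = \<zero>\<^bsub>R\<^esub> \<odot>\<^bsub>M\<^esub> x \<oplus>\<^bsub>M\<^esub> \<zero>\<^bsub>R\<^esub> \<odot>\<^bsub>M\<^esub> x"
    using smult_l_distr[of "\<zero>\<^bsub>R\<^esub>" "\<zero>\<^bsub>R\<^esub>" x] assms by simp
  then show ?thesis using assms by (metis M.add.r_cancel_one' smult_closed R.zero_closed)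
qed

lemma (in right_module) smult_r_null [simp]:
  assumes "r \<in> carrier R" shows "r \<odot>\<^bsub>M\<^esub> \<zero>\<^bsub>M\<^esub> = \<zero>\<^bsub>M\<^esub>"
proof -
  have "r \<odot>\<^bsub>M\<^esub> \<zero>\<^bsub>M\<^esub> = r \<odot>\<^bsub>M\<^esub> \<zero>\<^bsub>M\<^esub> \<oplus>\<^bsub>M\<^esub> r \<odot>\<^bsub>M\<^esub> \<zero>\<^bsub>M\<^esub>"
    using smult_r_distr[of r "\<zero>\<^bsub>M\<^esub>" "\<zero>\<^bsub>M\<^esub>"] assms by simp
  then show ?thesis using assms by (metis M.add.r_cancel_one' smult_closed M.zero_closed)
qed

lemma (in right_module) smult_finsum:
  assumes "finite T" "r \<in> carrier R" "f \<in> T \<rightarrow> carrier M"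
  shows "r \<odot>\<^bsub>M\<^esub> finsum M f T = finsum M (\<lambda>x. r \<odot>\<^bsub>M\<^esub> f x) T"
  using assms(1,3)
proof (induct T rule: finite_induct)
  case empty
  then show ?case using assms(2) by simp
next
  case (insert x F)
  then have "f \<in> F \<rightarrow> carrier M" "f x \<in> carrier M" by auto
  moreover have "(\<lambda>x. r \<odot>\<^bsub>M\<^esub> f x) \<in> F \<rightarrow> carrier M" using \<open>f \<in> F \<rightarrow> carrier M\<close> assms(2) by auto
  ultimately show ?case using insert assms(2) by (simp add: smult_r_distr)
qed

lemma right_module_homD:
  assumes "f \<in> right_module_hom R M N"
  shows "x \<in> carrier M \<Longrightarrow> f x \<in> carrier N"
    and "\<lbrakk> x \<in> carrier M; y \<in> carrier M \<rbrakk> \<Longrightarrow> f (x \<oplus>\<^bsub>M\<^esub> y) = f x \<oplus>\<^bsub>N\<^esub> f y"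
    and "\<lbrakk> r \<in> carrier R; x \<in> carrier M \<rbrakk> \<Longrightarrow> f (r \<odot>\<^bsub>M\<^esub> x) = r \<odot>\<^bsub>N\<^esub> f x"
  using assms by (auto simp: right_module_hom_def hom_def)

lemma right_module_homI:
  assumes "\<And>x. x \<in> carrier M \<Longrightarrow> f x \<in> carrier N"
    and "\<And>x y. \<lbrakk> x \<in> carrier M; y \<in> carrier M \<rbrakk> \<Longrightarrow> f (x \<oplus>\<^bsub>M\<^esub> y) = f x \<oplus>\<^bsub>N\<^esub> f y"
    and "\<And>r x. \<lbrakk> r \<in> carrier R; x \<in> carrier M \<rbrakk> \<Longrightarrow> f (r \<odot>\<^bsub>M\<^esub> x) = r \<odot>\<^bsub>N\<^esub> f x"
  shows "f \<in> right_module_hom R M N"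
  using assms by (auto simp: right_module_hom_def hom_def)

lemma right_module_hom_zero:
  assumes "right_module R M" "right_module R N" "f \<in> right_module_hom R M N"
  shows "f \<zero>\<^bsub>M\<^esub> = \<zero>\<^bsub>N\<^esub>"
proof -
  interpret M: right_module R M by fact
  interpret N: right_module R N by fact
  have "f (\<zero>\<^bsub>R\<^esub> \<odot>\<^bsub>M\<^esub> \<zero>\<^bsub>M\<^esub>) = \<zero>\<^bsub>R\<^esub> \<odot>\<^bsub>N\<^esub> f \<zero>\<^bsub>M\<^esub>"
    using right_module_homD(3)[OF assms(3)] by blast
  then show ?thesis using right_module_homD(1)[OF assms(3)] by simp
qed

lemma right_module_hom_finsum:
  assumes "right_module R M" "right_module R N" "f \<in> right_module_hom R M N"
    and "finite T" "u \<in> T \<rightarrow> carrier M"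
  shows "f (finsum M u T) = finsum N (\<lambda>x. f (u x)) T"
proof -
  interpret M: right_module R M by fact
  interpret N: right_module R N by fact
  show ?thesis using assms(4,5)
  proof (induct T rule: finite_induct)
    case empty
    then show ?case using right_module_hom_zero[OF assms(1-3)] by simp
  next
    case (insert x F)
    then have "u \<in> F \<rightarrow> carrier M" "u x \<in> carrier M" by auto
    moreover have "(\<lambda>x. f (u x)) \<in> F \<rightarrow> carrier N" "f (u x) \<in> carrier N"
      using calculation right_module_homD(1)[OF assms(3)] by auto
    ultimately show ?case using insert right_module_homD(2)[OF assms(3)] by simp
  qed
qed

definition free_right_module ::
  "('a, 'r) ring_scheme \<Rightarrow> 'b set \<Rightarrow> ('a, 'b \<Rightarrow> 'a) module" where
  "free_right_module R X =
     \<lparr>carrier = {c. range c \<subseteq> carrier R \<and> finite {x. c x \<noteq> \<zero>\<^bsub>R\<^esub>} \<and> {x. c x \<noteq> \<zero>\<^bsub>R\<^esub>} \<subseteq> X},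
      mult = (\<lambda>c d. c), one = (\<lambda>x. \<zero>\<^bsub>R\<^esub>), zero = (\<lambda>x. \<zero>\<^bsub>R\<^esub>),
      add = (\<lambda>c d x. c x \<oplus>\<^bsub>R\<^esub> d x), smult = (\<lambda>r c x. c x \<otimes>\<^bsub>R\<^esub> r)\<rparr>"

lemma free_right_moduleD:
  assumes "c \<in> carrier (free_right_module R X)"
  shows "c x \<in> carrier R" "finite {x. c x \<noteq> \<zero>\<^bsub>R\<^esub>}" "{x. c x \<noteq> \<zero>\<^bsub>R\<^esub>} \<subseteq> X"
  using assms by (auto simp: free_right_module_def)

lemma right_module_free:
  assumes "ring R" shows "right_module R (free_right_module R X)"
proof -
  interpret R: ring R by fact
  let ?F = "free_right_module R X"
  have add: "(\<lambda>x. c x \<oplus>\<^bsub>R\<^esub> d x) \<in> carrier ?F"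
    if c: "c \<in> carrier ?F" and d: "d \<in> carrier ?F" for c d
  proof -
    have sub: "{x. c x \<oplus>\<^bsub>R\<^esub> d x \<noteq> \<zero>\<^bsub>R\<^esub>} \<subseteq> {x. c x \<noteq> \<zero>\<^bsub>R\<^esub>} \<union> {x. d x \<noteq> \<zero>\<^bsub>R\<^esub>}" by auto
    then have "finite {x. c x \<oplus>\<^bsub>R\<^esub> d x \<noteq> \<zero>\<^bsub>R\<^esub>}"
      using free_right_moduleD(2)[OF c] free_right_moduleD(2)[OF d] finite_subset by blast
    moreover have "{x. c x \<oplus>\<^bsub>R\<^esub> d x \<noteq> \<zero>\<^bsub>R\<^esub>} \<subseteq> X"
      using sub free_right_moduleD(3)[OF c] free_right_moduleD(3)[OF d] by blast
    moreover have "range (\<lambda>x. c x \<oplus>\<^bsub>R\<^esub> d x) \<subseteq> carrier R"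
      using free_right_moduleD(1)[OF c] free_right_moduleD(1)[OF d] by auto
    ultimately show ?thesis by (simp add: free_right_module_def)
  qed
  have smult: "(\<lambda>x. c x \<otimes>\<^bsub>R\<^esub> r) \<in> carrier ?F"
    if c: "c \<in> carrier ?F" and r: "r \<in> carrier R" for c r
  proof -
    have sub: "{x. c x \<otimes>\<^bsub>R\<^esub> r \<noteq> \<zero>\<^bsub>R\<^esub>} \<subseteq> {x. c x \<noteq> \<zero>\<^bsub>R\<^esub>}" using r by auto
    then have "finite {x. c x \<otimes>\<^bsub>R\<^esub> r \<noteq> \<zero>\<^bsub>R\<^esub>}"
      using free_right_moduleD(2)[OF c] finite_subset by blast
    moreover have "{x. c x \<otimes>\<^bsub>R\<^esub> r \<noteq> \<zero>\<^bsub>R\<^esub>} \<subseteq> X"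
      using sub free_right_moduleD(3)[OF c] by blast
    moreover have "range (\<lambda>x. c x \<otimes>\<^bsub>R\<^esub> r) \<subseteq> carrier R"
      using free_right_moduleD(1)[OF c] r by auto
    ultimately show ?thesis by (simp add: free_right_module_def)
  qed
  have eqs: "add ?F = (\<lambda>c d x. c x \<oplus>\<^bsub>R\<^esub> d x)" "zero ?F = (\<lambda>x. \<zero>\<^bsub>R\<^esub>)"
    "smult ?F = (\<lambda>r c x. c x \<otimes>\<^bsub>R\<^esub> r)"
    by (simp_all add: free_right_module_def)
  have zero: "(\<lambda>x. \<zero>\<^bsub>R\<^esub>) \<in> carrier ?F" by (auto simp: free_right_module_def)
  have ag: "abelian_group ?F"
  proof (rule abelian_groupI, unfold eqs)
    fix c assume c: "c \<in> carrier ?F"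
    have "(\<lambda>x. c x \<otimes>\<^bsub>R\<^esub> (\<ominus>\<^bsub>R\<^esub> \<one>\<^bsub>R\<^esub>)) \<in> carrier ?F" by (rule smult[OF c]) simp
    moreover have "(\<lambda>x. c x \<otimes>\<^bsub>R\<^esub> (\<ominus>\<^bsub>R\<^esub> \<one>\<^bsub>R\<^esub>) \<oplus>\<^bsub>R\<^esub> c x) = (\<lambda>x. \<zero>\<^bsub>R\<^esub>)"
      using free_right_moduleD(1)[OF c] by (simp add: R.r_minus R.l_neg)
    ultimately show "\<exists>d\<in>carrier ?F. (\<lambda>x. d x \<oplus>\<^bsub>R\<^esub> c x) = (\<lambda>x. \<zero>\<^bsub>R\<^esub>)"
      by (intro bexI[of _ "\<lambda>x. c x \<otimes>\<^bsub>R\<^esub> (\<ominus>\<^bsub>R\<^esub> \<one>\<^bsub>R\<^esub>)"]) auto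
  next
    fix c d e
    assume "c \<in> carrier ?F" "d \<in> carrier ?F" "e \<in> carrier ?F"
    note cl = this[THEN free_right_moduleD(1)]
    show "(\<lambda>x. c x \<oplus>\<^bsub>R\<^esub> d x \<oplus>\<^bsub>R\<^esub> e x) = (\<lambda>x. c x \<oplus>\<^bsub>R\<^esub> (d x \<oplus>\<^bsub>R\<^esub> e x))"
      by (rule ext) (rule R.a_assoc[OF cl])
  next
    fix c d
    assume "c \<in> carrier ?F" "d \<in> carrier ?F"
    note cl = this[THEN free_right_moduleD(1)]
    show "(\<lambda>x. c x \<oplus>\<^bsub>R\<^esub> d x) = (\<lambda>x. d x \<oplus>\<^bsub>R\<^esub> c x)"
      by (rule ext) (rule R.a_comm[OF cl])
  next
    fix c assume "c \<in> carrier ?F"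
    note cl = free_right_moduleD(1)[OF this]
    show "(\<lambda>x. \<zero>\<^bsub>R\<^esub> \<oplus>\<^bsub>R\<^esub> c x) = c"
      by (rule ext) (rule R.l_zero[OF cl])
  qed (use add zero in auto)
  have cl: "c x \<in> carrier R" if "c \<in> carrier ?F" for c x
    by (rule free_right_moduleD(1)[OF that])
  have ax: "right_module_axioms R ?F"
    unfolding right_module_axioms_def eqs
    using smult cl by (auto simp: fun_eq_iff R.r_distr R.l_distr R.m_assoc)
  show ?thesis using assms ag ax by (simp add: right_module_def)
qed

definition free_extension ::
  "('a, 'r) ring_scheme \<Rightarrow> ('a, 'c, 'm) module_scheme \<Rightarrow> ('b \<Rightarrow> 'c) \<Rightarrow> ('b \<Rightarrow> 'a) \<Rightarrow> 'c" where
  "free_extension R A u c = finsum A (\<lambda>x. c x \<odot>\<^bsub>A\<^esub> u x) {x. c x \<noteq> \<zero>\<^bsub>R\<^esub>}"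

lemma free_extension_superset:
  assumes "right_module R A" "u \<in> X \<rightarrow> carrier A" "c \<in> carrier (free_right_module R X)"
    and "finite T" "{x. c x \<noteq> \<zero>\<^bsub>R\<^esub>} \<subseteq> T" "T \<subseteq> X"
  shows "free_extension R A u c = finsum A (\<lambda>x. c x \<odot>\<^bsub>A\<^esub> u x) T"
proof -
  interpret A: right_module R A by fact
  show ?thesis unfolding free_extension_def
    using assms(2,4-6) free_right_moduleD(1)[OF assms(3)]
    by (intro A.add.finprod_mono_neutral_cong_left) (auto simp: Pi_iff subset_iff)
qed

lemma free_extension_hom:
  assumes A: "right_module R A" and u: "u \<in> X \<rightarrow> carrier A"
  shows "free_extension R A u \<in> right_module_hom R (free_right_module R X) A"
proof -
  interpret A: right_module R A by fact
  let ?F = "free_right_module R X"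
  interpret F: right_module R ?F by (rule right_module_free) (rule A.R.ring_axioms)
  have cl: "(\<lambda>x. c x \<odot>\<^bsub>A\<^esub> u x) \<in> T \<rightarrow> carrier A" if "c \<in> carrier ?F" "T \<subseteq> X" for c T
    using u that free_right_moduleD(1)[OF that(1)] by auto
  show ?thesis
  proof (rule right_module_homI)
    fix c assume c: "c \<in> carrier ?F"
    show "free_extension R A u c \<in> carrier A" unfolding free_extension_def
      by (intro A.M.finsum_closed cl[OF c] free_right_moduleD(3)[OF c])
  next
    fix c d assume c: "c \<in> carrier ?F" and d: "d \<in> carrier ?F"
    let ?T = "{x. c x \<noteq> \<zero>\<^bsub>R\<^esub>} \<union> {x. d x \<noteq> \<zero>\<^bsub>R\<^esub>}"
    have T: "finite ?T" "?T \<subseteq> X"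
      using free_right_moduleD(2,3)[OF c] free_right_moduleD(2,3)[OF d] by auto
    have e: "(c \<oplus>\<^bsub>?F\<^esub> d) x = c x \<oplus>\<^bsub>R\<^esub> d x" for x by (simp add: free_right_module_def)
    have cd: "c \<oplus>\<^bsub>?F\<^esub> d \<in> carrier ?F" using c d by simp
    have "free_extension R A u (c \<oplus>\<^bsub>?F\<^esub> d) = finsum A (\<lambda>x. (c \<oplus>\<^bsub>?F\<^esub> d) x \<odot>\<^bsub>A\<^esub> u x) ?T"
      by (rule free_extension_superset[OF A u cd T(1) _ T(2)]) (auto simp: e)
    also have "\<dots> = finsum A (\<lambda>x. c x \<odot>\<^bsub>A\<^esub> u x \<oplus>\<^bsub>A\<^esub> d x \<odot>\<^bsub>A\<^esub> u x) ?T"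
    proof (rule A.M.finsum_cong'[OF refl])
      show "(\<lambda>x. c x \<odot>\<^bsub>A\<^esub> u x \<oplus>\<^bsub>A\<^esub> d x \<odot>\<^bsub>A\<^esub> u x) \<in> ?T \<rightarrow> carrier A"
        using cl[OF c T(2)] cl[OF d T(2)] by (auto simp: Pi_iff)
      show "(c \<oplus>\<^bsub>?F\<^esub> d) x \<odot>\<^bsub>A\<^esub> u x = c x \<odot>\<^bsub>A\<^esub> u x \<oplus>\<^bsub>A\<^esub> d x \<odot>\<^bsub>A\<^esub> u x" if "x \<in> ?T" for x
        unfolding e using that T(2) u
        by (intro A.smult_l_distr free_right_moduleD(1)[OF c] free_right_moduleD(1)[OF d]) auto
    qed
    also have "\<dots> = finsum A (\<lambda>x. c x \<odot>\<^bsub>A\<^esub> u x) ?T \<oplus>\<^bsub>A\<^esub> finsum A (\<lambda>x. d x \<odot>\<^bsub>A\<^esub> u x) ?T"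
      by (rule A.M.finsum_addf[OF cl[OF c T(2)] cl[OF d T(2)]])
    also have "\<dots> = free_extension R A u c \<oplus>\<^bsub>A\<^esub> free_extension R A u d"
      using free_extension_superset[OF A u c T(1) _ T(2)]
        free_extension_superset[OF A u d T(1) _ T(2)] by auto
    finally show "free_extension R A u (c \<oplus>\<^bsub>?F\<^esub> d) =
      free_extension R A u c \<oplus>\<^bsub>A\<^esub> free_extension R A u d" .
  next
    fix r c assume r: "r \<in> carrier R" and c: "c \<in> carrier ?F"
    let ?T = "{x. c x \<noteq> \<zero>\<^bsub>R\<^esub>}"
    note T = free_right_moduleD(2,3)[OF c]
    have e: "(r \<odot>\<^bsub>?F\<^esub> c) x = c x \<otimes>\<^bsub>R\<^esub> r" for x by (simp add: free_right_module_def)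
    have rc: "r \<odot>\<^bsub>?F\<^esub> c \<in> carrier ?F" using c r by (rule F.smult_closed[rotated])
    have "free_extension R A u (r \<odot>\<^bsub>?F\<^esub> c) = finsum A (\<lambda>x. (r \<odot>\<^bsub>?F\<^esub> c) x \<odot>\<^bsub>A\<^esub> u x) ?T"
      by (rule free_extension_superset[OF A u rc T(1) _ T(2)]) (auto simp: e r)
    also have "\<dots> = finsum A (\<lambda>x. r \<odot>\<^bsub>A\<^esub> (c x \<odot>\<^bsub>A\<^esub> u x)) ?T"
    proof (rule A.M.finsum_cong'[OF refl])
      show "(\<lambda>x. r \<odot>\<^bsub>A\<^esub> (c x \<odot>\<^bsub>A\<^esub> u x)) \<in> ?T \<rightarrow> carrier A"
        using cl[OF c T(2)] r by (auto simp: Pi_iff)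
      show "(r \<odot>\<^bsub>?F\<^esub> c) x \<odot>\<^bsub>A\<^esub> u x = r \<odot>\<^bsub>A\<^esub> (c x \<odot>\<^bsub>A\<^esub> u x)" if "x \<in> ?T" for x
        unfolding e using that T(2) u
        by (intro A.smult_assoc free_right_moduleD(1)[OF c] r) auto
    qed
    also have "\<dots> = r \<odot>\<^bsub>A\<^esub> free_extension R A u c"
      unfolding free_extension_def by (rule A.smult_finsum[OF T(1) r cl[OF c T(2)], symmetric])
    finally show "free_extension R A u (r \<odot>\<^bsub>?F\<^esub> c) = r \<odot>\<^bsub>A\<^esub> free_extension R A u c" .
  qed
qed

lemma hom_free_extension:
  assumes A: "right_module R A" and B: "right_module R B" and k: "k \<in> right_module_hom R A B"
    and u: "u \<in> X \<rightarrow> carrier A" and c: "c \<in> carrier (free_right_module R X)"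
  shows "k (free_extension R A u c) = free_extension R B (\<lambda>x. k (u x)) c"
proof -
  interpret A: right_module R A by fact
  interpret B: right_module R B by fact
  let ?T = "{x. c x \<noteq> \<zero>\<^bsub>R\<^esub>}"
  note T = free_right_moduleD(2,3)[OF c]
  have uT: "x \<in> ?T \<Longrightarrow> u x \<in> carrier A" for x using u T(2) by auto
  have cl: "(\<lambda>x. c x \<odot>\<^bsub>A\<^esub> u x) \<in> ?T \<rightarrow> carrier A"
    using uT free_right_moduleD(1)[OF c] by auto
  have "k (free_extension R A u c) = finsum B (\<lambda>x. k (c x \<odot>\<^bsub>A\<^esub> u x)) ?T"
    unfolding free_extension_def by (rule right_module_hom_finsum[OF A B k T(1) cl])
  also have "\<dots> = free_extension R B (\<lambda>x. k (u x)) c"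
    unfolding free_extension_def
  proof (rule B.M.finsum_cong'[OF refl])
    show "(\<lambda>x. c x \<odot>\<^bsub>B\<^esub> k (u x)) \<in> ?T \<rightarrow> carrier B"
      using uT free_right_moduleD(1)[OF c] right_module_homD(1)[OF k] by blast
    show "k (c x \<odot>\<^bsub>A\<^esub> u x) = c x \<odot>\<^bsub>B\<^esub> k (u x)" if "x \<in> ?T" for x
      by (rule right_module_homD(3)[OF k free_right_moduleD(1)[OF c] uT[OF that]])
  qed
  finally show ?thesis .
qed

lemma free_extension_cong:
  assumes B: "right_module R B" and c: "c \<in> carrier (free_right_module R X)"
    and v: "v \<in> X \<rightarrow> carrier B" and uv: "\<And>x. x \<in> X \<Longrightarrow> u x = v x"
  shows "free_extension R B u c = free_extension R B v c"
proof -
  interpret B: right_module R B by fact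
  note T = free_right_moduleD(2,3)[OF c]
  have vT: "v x \<in> carrier B" if "c x \<noteq> \<zero>\<^bsub>R\<^esub>" for x using T(2) v that by blast
  show ?thesis unfolding free_extension_def
    by (rule B.M.finsum_cong'[OF refl])
      (use T(2) vT uv free_right_moduleD(1)[OF c] in auto)
qed

lemma free_extension_basis:
  assumes A: "right_module R A" and u: "u \<in> X \<rightarrow> carrier A" and x: "x \<in> X"
  defines "b \<equiv> (\<lambda>y. if y = x then \<one>\<^bsub>R\<^esub> else \<zero>\<^bsub>R\<^esub>)"
  shows "b \<in> carrier (free_right_module R X)" "free_extension R A u b = u x"
proof -
  interpret A: right_module R A by fact
  have sub: "{y. b y \<noteq> \<zero>\<^bsub>R\<^esub>} \<subseteq> {x}" by (auto simp: b_def)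
  have "finite {y. b y \<noteq> \<zero>\<^bsub>R\<^esub>}" using sub finite_subset by blast
  then show b: "b \<in> carrier (free_right_module R X)"
    using sub x by (auto simp: free_right_module_def b_def)
  have ux: "u x \<in> carrier A" using u x by auto
  have "free_extension R A u b = finsum A (\<lambda>y. b y \<odot>\<^bsub>A\<^esub> u y) {x}"
    by (rule free_extension_superset[OF A u b _ sub]) (use x in auto)
  also have "\<dots> = u x" using ux by (simp add: b_def)
  finally show "free_extension R A u b = u x" .
qed

theorem projective_lifting:
  fixes P :: "('a, 'b, 'k) module_scheme"
    and A :: "('a, 'c, 'm) module_scheme" and B :: "('a, 'd, 'n) module_scheme"
  assumes P: "projective_right_module R P" and A: "right_module R A" and B: "right_module R B"
  shows "lifting_property R P A B"
  unfolding lifting_property_def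
proof (intro allI impI, elim conjE)
  fix f g
  assume f: "f \<in> right_module_hom R A B" and surj: "f ` carrier A = carrier B"
    and g: "g \<in> right_module_hom R P B"
  have PM: "right_module R P" using P by (simp add: projective_right_module_def)
  interpret PM: right_module R P by fact
  let ?X = "carrier P"
  let ?F = "free_right_module R ?X"
  let ?Q = "module.truncate P"
  let ?pi = "free_extension R ?Q (\<lambda>x. x)"
  have sel: "carrier ?Q = carrier P" "add ?Q = add P" "zero ?Q = zero P" "smult ?Q = smult P"
    by (simp_all add: module.truncate_def)
  have Q: "right_module R ?Q"
  proof -
    have "abelian_group ?Q"
    proof (rule abelian_groupI, unfold sel)
      fix x assume "x \<in> carrier P"
      then show "\<exists>y\<in>carrier P. y \<oplus>\<^bsub>P\<^esub> x = \<zero>\<^bsub>P\<^esub>"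
        using PM.M.l_neg PM.M.a_inv_closed by blast
    next
      fix x y z assume "x \<in> carrier P" "y \<in> carrier P" "z \<in> carrier P"
      then show "x \<oplus>\<^bsub>P\<^esub> y \<oplus>\<^bsub>P\<^esub> z = x \<oplus>\<^bsub>P\<^esub> (y \<oplus>\<^bsub>P\<^esub> z)" by (rule PM.M.a_assoc)
    next
      fix x y assume "x \<in> carrier P" "y \<in> carrier P"
      then show "x \<oplus>\<^bsub>P\<^esub> y = y \<oplus>\<^bsub>P\<^esub> x" by (rule PM.M.a_comm)
    qed simp_all
    moreover have "right_module_axioms R ?Q"
      unfolding right_module_axioms_def sel
      by (simp add: PM.smult_l_distr PM.smult_r_distr PM.smult_assoc)
    ultimately show ?thesis using PM.R.ring_axioms by (simp add: right_module_def)
  qed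
  have F: "right_module R ?F" by (rule right_module_free[OF PM.R.ring_axioms])
  have idQ: "(\<lambda>x. x) \<in> ?X \<rightarrow> carrier ?Q" by (simp add: sel)
  have pi: "?pi \<in> right_module_hom R ?F ?Q" by (rule free_extension_hom[OF Q idQ])
  have pi_surj: "?pi ` carrier ?F = carrier ?Q"
  proof
    show "?pi ` carrier ?F \<subseteq> carrier ?Q" using right_module_homD(1)[OF pi] by blast
    show "carrier ?Q \<subseteq> ?pi ` carrier ?F"
      using free_extension_basis[OF Q idQ] by (force simp: sel)
  qed
  have idP: "(\<lambda>x. x) \<in> right_module_hom R P ?Q" by (rule right_module_homI) (simp_all add: sel)
  have "lifting_property R P ?F ?Q"
    using P F Q unfolding projective_right_module_def by blast
  then obtain s where s: "s \<in> right_module_hom R P ?F" and pis: "\<And>x. x \<in> ?X \<Longrightarrow> ?pi (s x) = x"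
    unfolding lifting_property_def using pi pi_surj idP by blast
  have gB: "g x \<in> carrier B" if "x \<in> ?X" for x by (rule right_module_homD(1)[OF g that])
  have "\<exists>a. a \<in> carrier A \<and> f a = g x" if "x \<in> ?X" for x using gB[OF that] surj by (metis imageE)
  then obtain u where u: "\<And>x. x \<in> ?X \<Longrightarrow> u x \<in> carrier A \<and> f (u x) = g x" by metis
  have uX: "u \<in> ?X \<rightarrow> carrier A" using u by auto
  let ?phi = "free_extension R A u"
  have phi: "?phi \<in> right_module_hom R ?F A" by (rule free_extension_hom[OF A uX])
  have gQ: "g \<in> right_module_hom R ?Q B"
    using right_module_homD[OF g] by (intro right_module_homI) (simp_all add: sel)
  show "\<exists>h\<in>right_module_hom R P A. \<forall>x\<in>carrier P. f (h x) = g x"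
  proof (rule bexI[of _ "\<lambda>x. ?phi (s x)"], intro ballI)
    fix x assume x: "x \<in> ?X"
    have sx: "s x \<in> carrier ?F" by (rule right_module_homD(1)[OF s x])
    have "f (?phi (s x)) = free_extension R B (\<lambda>y. f (u y)) (s x)"
      by (rule hom_free_extension[OF A B f uX sx])
    also have "\<dots> = free_extension R B g (s x)"
      by (rule free_extension_cong[OF B sx]) (use u gB in auto)
    also have "\<dots> = g (?pi (s x))" by (rule hom_free_extension[OF Q B gQ idQ sx, symmetric])
    also have "\<dots> = g x" using pis[OF x] by simp
    finally show "f (?phi (s x)) = g x" .
  next
    show "(\<lambda>x. ?phi (s x)) \<in> right_module_hom R P A"
      using right_module_homD[OF s] right_module_homD[OF phi]
      by (intro right_module_homI) simp_all
  qed
qed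

end

theory Submission
  imports Defs
begin

text \<open>
  Write \<open>J\<close> for the Jacobson radical of \<open>R\<close> and \<open>Rad M\<close> for the intersection of the maximal
  submodules of \<open>M\<close>.  The idea is to split off projective summands until none is left; the
  process stops because every new summand is visible modulo \<open>Rad M\<close>, and \<open>M / Rad M\<close> is a
  noetherian module.

  Two facts carry this.  First, \<open>M \<cdot> J\<close> lies in \<open>Rad M\<close> (\<open>smult_radical\<close>): for a maximal submodule
  \<open>K\<close> and \<open>x \<notin> K\<close>, the elements \<open>r\<close> with \<open>x \<cdot> r \<in> K\<close> form a maximal right ideal.  So submodules
  above \<open>Rad M\<close> are controlled by right ideals above \<open>J\<close>.  Semisimplicity of \<open>R / J\<close> makes each of
  these principal modulo \<open>J\<close> (\<open>semilocal_right_ideal_principal\<close>), and the usual argument, adding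
  one generator at a time, gives the noetherian property of a finitely generated \<open>M\<close> above
  \<open>Rad M\<close> (\<open>noetherian_over_radical\<close>).

  Secondly, \<open>Rad M\<close> is superfluous in a finitely generated \<open>M\<close> (\<open>radical_superfluous\<close>, a form of
  Nakayama's lemma): a proper submodule lies in a maximal one, hence cannot add up to \<open>M\<close> with
  \<open>Rad M\<close>.  If \<open>M = P \<oplus> Q \<oplus> L\<close> and \<open>Q \<subseteq> P + Rad M\<close>, then \<open>(P + L) + Rad M = M\<close>, so \<open>P + L = M\<close>
  and \<open>Q = 0\<close>.

  Choose a decomposition \<open>M = P \<oplus> N\<close> with \<open>P\<close> projective and \<open>P + Rad M\<close> maximal, which the
  noetherian property permits; \<open>P = 0\<close> shows that there is at least one.  If \<open>N = Q \<oplus> L\<close> with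
  \<open>Q\<close> projective, then \<open>P \<oplus> Q\<close> is again a projective summand (\<open>projective_add\<close>), so
  maximality gives \<open>Q \<subseteq> P + Rad M\<close> and hence \<open>Q = 0\<close>: the module \<open>N\<close> is stable.
\<close>

section \<open>Submodules of right modules\<close>

lemma submoduleD:
  assumes "submodule H R M"
  shows "H \<subseteq> carrier M" "\<zero>\<^bsub>M\<^esub> \<in> H"
    and "\<lbrakk> x \<in> H; y \<in> H \<rbrakk> \<Longrightarrow> x \<oplus>\<^bsub>M\<^esub> y \<in> H"
    and "\<lbrakk> r \<in> carrier R; x \<in> H \<rbrakk> \<Longrightarrow> r \<odot>\<^bsub>M\<^esub> x \<in> H"
proof -
  interpret submodule H R M by fact
  show "H \<subseteq> carrier M" "\<zero>\<^bsub>M\<^esub> \<in> H"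
    "\<lbrakk> x \<in> H; y \<in> H \<rbrakk> \<Longrightarrow> x \<oplus>\<^bsub>M\<^esub> y \<in> H"
    "\<lbrakk> r \<in> carrier R; x \<in> H \<rbrakk> \<Longrightarrow> r \<odot>\<^bsub>M\<^esub> x \<in> H"
    using subset one_closed m_closed smult_closed by simp_all
qed

lemma mem_set_add_iff: "z \<in> A <+>\<^bsub>M\<^esub> B \<longleftrightarrow> (\<exists>a\<in>A. \<exists>b\<in>B. z = a \<oplus>\<^bsub>M\<^esub> b)"
  by (auto simp: set_add_defs)

context right_module
begin

lemma smult_minus_one:
  assumes "x \<in> carrier M"
  shows "(\<ominus>\<^bsub>R\<^esub> \<one>\<^bsub>R\<^esub>) \<odot>\<^bsub>M\<^esub> x = \<ominus>\<^bsub>M\<^esub> x"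
proof -
  have "(\<ominus>\<^bsub>R\<^esub> \<one>\<^bsub>R\<^esub>) \<odot>\<^bsub>M\<^esub> x \<oplus>\<^bsub>M\<^esub> x = (\<ominus>\<^bsub>R\<^esub> \<one>\<^bsub>R\<^esub> \<oplus>\<^bsub>R\<^esub> \<one>\<^bsub>R\<^esub>) \<odot>\<^bsub>M\<^esub> x"
    using assms by (simp add: smult_l_distr)
  also have "\<dots> = \<zero>\<^bsub>M\<^esub>" using assms by (simp add: R.l_neg)
  finally show ?thesis using assms by (metis M.minus_equality R.a_inv_closed R.one_closed smult_closed)
qed

text \<open>Closure under negation is automatic, since \<open>- x = x \<cdot> (-1)\<close>.\<close>

lemma submoduleI:
  assumes "H \<subseteq> carrier M" "\<zero>\<^bsub>M\<^esub> \<in> H"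
    and "\<And>x y. \<lbrakk> x \<in> H; y \<in> H \<rbrakk> \<Longrightarrow> x \<oplus>\<^bsub>M\<^esub> y \<in> H"
    and "\<And>r x. \<lbrakk> r \<in> carrier R; x \<in> H \<rbrakk> \<Longrightarrow> r \<odot>\<^bsub>M\<^esub> x \<in> H"
  shows "submodule H R M"
proof (intro submodule.intro subgroup.intro submodule_axioms.intro)
  fix x assume x: "x \<in> H"
  then have "(\<ominus>\<^bsub>R\<^esub> \<one>\<^bsub>R\<^esub>) \<odot>\<^bsub>M\<^esub> x \<in> H" using assms(4) by simp
  then show "inv\<^bsub>add_monoid M\<^esub> x \<in> H"
    using smult_minus_one x assms(1) by (auto simp: a_inv_def)
qed (use assms in auto)

lemma submodule_minus:
  assumes "submodule H R M" "x \<in> H" "y \<in> H"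
  shows "x \<ominus>\<^bsub>M\<^esub> y \<in> H"
proof -
  have "(\<ominus>\<^bsub>R\<^esub> \<one>\<^bsub>R\<^esub>) \<odot>\<^bsub>M\<^esub> y \<in> H" using submoduleD(4)[OF assms(1)] assms(3) by simp
  then show ?thesis
    using smult_minus_one submoduleD(1,3)[OF assms(1)] assms(2,3)
    by (auto simp: a_minus_def subset_iff)
qed

lemma submodule_carrier: "submodule (carrier M) R M"
  by (rule submoduleI) auto

lemma submodule_zero: "submodule {\<zero>\<^bsub>M\<^esub>} R M"
  by (rule submoduleI) auto

lemma submodule_Int:
  assumes "submodule A R M" "submodule B R M"
  shows "submodule (A \<inter> B) R M"
  by (rule submoduleI) (use submoduleD[OF assms(1)] submoduleD[OF assms(2)] in auto)

lemma submodule_add: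
  assumes A: "submodule A R M" and B: "submodule B R M"
  shows "submodule (A <+>\<^bsub>M\<^esub> B) R M"
proof (rule submoduleI)
  note sub = submoduleD(1)[OF A, THEN subsetD] submoduleD(1)[OF B, THEN subsetD]
  show "A <+>\<^bsub>M\<^esub> B \<subseteq> carrier M" using sub by (auto simp: mem_set_add_iff)
  show "\<zero>\<^bsub>M\<^esub> \<in> A <+>\<^bsub>M\<^esub> B"
    using submoduleD(2)[OF A] submoduleD(2)[OF B] M.l_zero[OF M.zero_closed]
    unfolding mem_set_add_iff by metis
next
  note sub = submoduleD(1)[OF A, THEN subsetD] submoduleD(1)[OF B, THEN subsetD]
  fix x y assume "x \<in> A <+>\<^bsub>M\<^esub> B" "y \<in> A <+>\<^bsub>M\<^esub> B"
  then obtain a b a' b' where x: "a \<in> A" "b \<in> B" "x = a \<oplus>\<^bsub>M\<^esub> b"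
    and y: "a' \<in> A" "b' \<in> B" "y = a' \<oplus>\<^bsub>M\<^esub> b'"
    unfolding mem_set_add_iff by blast
  have "x \<oplus>\<^bsub>M\<^esub> y = (a \<oplus>\<^bsub>M\<^esub> a') \<oplus>\<^bsub>M\<^esub> (b \<oplus>\<^bsub>M\<^esub> b')"
    using x y sub by (simp add: M.a_ac)
  then show "x \<oplus>\<^bsub>M\<^esub> y \<in> A <+>\<^bsub>M\<^esub> B"
    using x y submoduleD(3)[OF A] submoduleD(3)[OF B] unfolding mem_set_add_iff by metis
next
  note sub = submoduleD(1)[OF A, THEN subsetD] submoduleD(1)[OF B, THEN subsetD]
  fix r x assume r: "r \<in> carrier R" and "x \<in> A <+>\<^bsub>M\<^esub> B"
  then obtain a b where x: "a \<in> A" "b \<in> B" "x = a \<oplus>\<^bsub>M\<^esub> b"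
    unfolding mem_set_add_iff by blast
  have "r \<odot>\<^bsub>M\<^esub> x = r \<odot>\<^bsub>M\<^esub> a \<oplus>\<^bsub>M\<^esub> r \<odot>\<^bsub>M\<^esub> b"
    using x r sub by (simp add: smult_r_distr)
  then show "r \<odot>\<^bsub>M\<^esub> x \<in> A <+>\<^bsub>M\<^esub> B"
    using x r submoduleD(4)[OF A] submoduleD(4)[OF B] unfolding mem_set_add_iff by metis
qed

lemma subset_set_add:
  assumes A: "submodule A R M" and B: "submodule B R M"
  shows "A \<subseteq> A <+>\<^bsub>M\<^esub> B" "B \<subseteq> A <+>\<^bsub>M\<^esub> B"
proof -
  show "A \<subseteq> A <+>\<^bsub>M\<^esub> B"
    using submoduleD(1)[OF A] submoduleD(2)[OF B] M.r_zero unfolding mem_set_add_iff subset_iff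
    by metis
  show "B \<subseteq> A <+>\<^bsub>M\<^esub> B"
    using submoduleD(1)[OF B] submoduleD(2)[OF A] M.l_zero unfolding mem_set_add_iff subset_iff
    by metis
qed

lemma set_add_least:
  assumes C: "submodule C R M" and "A \<subseteq> C" "B \<subseteq> C"
  shows "A <+>\<^bsub>M\<^esub> B \<subseteq> C"
  unfolding subset_iff mem_set_add_iff using assms(2,3) submoduleD(3)[OF C] by blast

lemma submodule_cyclic:
  assumes x: "x \<in> carrier M"
  shows "submodule {r \<odot>\<^bsub>M\<^esub> x | r. r \<in> carrier R} R M"
proof (rule submoduleI)
  show "{r \<odot>\<^bsub>M\<^esub> x | r. r \<in> carrier R} \<subseteq> carrier M" using x by auto
  show "\<zero>\<^bsub>M\<^esub> \<in> {r \<odot>\<^bsub>M\<^esub> x | r. r \<in> carrier R}"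
    using x by (force intro: exI[of _ "\<zero>\<^bsub>R\<^esub>"])
next
  fix y z assume "y \<in> {r \<odot>\<^bsub>M\<^esub> x | r. r \<in> carrier R}" "z \<in> {r \<odot>\<^bsub>M\<^esub> x | r. r \<in> carrier R}"
  then show "y \<oplus>\<^bsub>M\<^esub> z \<in> {r \<odot>\<^bsub>M\<^esub> x | r. r \<in> carrier R}"
    using x smult_l_distr[symmetric] by blast
next
  fix s y assume "s \<in> carrier R" "y \<in> {r \<odot>\<^bsub>M\<^esub> x | r. r \<in> carrier R}"
  then show "s \<odot>\<^bsub>M\<^esub> y \<in> {r \<odot>\<^bsub>M\<^esub> x | r. r \<in> carrier R}"
    using x smult_assoc[symmetric] by blast
qed

lemma mem_cyclic:
  assumes "x \<in> carrier M"
  shows "x \<in> {r \<odot>\<^bsub>M\<^esub> x | r. r \<in> carrier R}"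
  using assms by (force intro: exI[of _ "\<one>\<^bsub>R\<^esub>"])

lemma submodule_Union_chain:
  assumes ch: "subset.chain A C" and ne: "C \<noteq> {}" and sm: "\<And>L. L \<in> C \<Longrightarrow> submodule L R M"
  shows "submodule (\<Union>C) R M"
proof (rule submoduleI)
  show "\<Union>C \<subseteq> carrier M" using submoduleD(1)[OF sm] by blast
  show "\<zero>\<^bsub>M\<^esub> \<in> \<Union>C" using ne submoduleD(2)[OF sm] by blast
next
  fix x y assume xy: "x \<in> \<Union>C" "y \<in> \<Union>C"
  obtain L where "L \<in> C" "{x, y} \<subseteq> L"
    by (rule finite_subset_Union_chain[OF _ _ ne ch, of "{x, y}"]) (use xy in auto)
  then show "x \<oplus>\<^bsub>M\<^esub> y \<in> \<Union>C" using submoduleD(3)[OF sm] by blast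
next
  fix r x assume "r \<in> carrier R" "x \<in> \<Union>C"
  then show "r \<odot>\<^bsub>M\<^esub> x \<in> \<Union>C" using submoduleD(4)[OF sm] by blast
qed

lemma right_module_submodule:
  assumes H: "submodule H R M"
  shows "right_module R (M\<lparr>carrier := H\<rparr>)"
proof -
  note sub = submoduleD(1)[OF H, THEN subsetD]
  have "abelian_group (M\<lparr>carrier := H\<rparr>)"
  proof (rule abelian_groupI)
    fix x assume x: "x \<in> carrier (M\<lparr>carrier := H\<rparr>)"
    have "\<zero>\<^bsub>M\<^esub> \<ominus>\<^bsub>M\<^esub> x \<in> H" using submodule_minus[OF H submoduleD(2)[OF H]] x by simp
    moreover have "\<zero>\<^bsub>M\<^esub> \<ominus>\<^bsub>M\<^esub> x \<oplus>\<^bsub>M\<^esub> x = \<zero>\<^bsub>M\<^esub>"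
      using sub x by (simp add: a_minus_def M.l_neg)
    ultimately show "\<exists>y\<in>carrier (M\<lparr>carrier := H\<rparr>).
        y \<oplus>\<^bsub>M\<lparr>carrier := H\<rparr>\<^esub> x = \<zero>\<^bsub>M\<lparr>carrier := H\<rparr>\<^esub>" by force
  qed (use sub submoduleD[OF H] in \<open>auto simp: M.a_ac\<close>)
  moreover have "right_module_axioms R (M\<lparr>carrier := H\<rparr>)"
    unfolding right_module_axioms_def using sub submoduleD(4)[OF H]
    by (simp add: smult_l_distr smult_r_distr smult_assoc)
  ultimately show ?thesis using R.ring_axioms by (simp add: right_module_def)
qed

lemma submodule_of_submodule:
  assumes "submodule H R M" and "submodule L R (M\<lparr>carrier := H\<rparr>)"
  shows "L \<subseteq> H" "submodule L R M"
proof -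
  note L = submoduleD[OF assms(2)]
  show "L \<subseteq> H" using L(1) by simp
  then show "submodule L R M"
    using L submoduleD(1)[OF assms(1)] by (intro submoduleI) auto
qed

end

lemma right_module_regular:
  assumes "ring R" shows "right_module R (regular_right_module R)"
proof -
  interpret R: ring R by fact
  let ?M = "regular_right_module R"
  have "abelian_group ?M"
  proof (rule abelian_groupI)
    fix x assume "x \<in> carrier ?M"
    then show "\<exists>y\<in>carrier ?M. y \<oplus>\<^bsub>?M\<^esub> x = \<zero>\<^bsub>?M\<^esub>"
      using R.l_neg R.a_inv_closed unfolding regular_right_module_def by auto
  qed (auto simp: regular_right_module_def R.a_ac)
  moreover have "right_module_axioms R ?M"
    by (simp add: right_module_axioms_def regular_right_module_def R.l_distr R.r_distr R.m_assoc)
  ultimately show ?thesis using R.ring_axioms by (simp add: right_module_def)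
qed

lemma right_idealI:
  assumes "ring R" "I \<subseteq> carrier R" "\<zero>\<^bsub>R\<^esub> \<in> I"
    and "\<And>x y. \<lbrakk> x \<in> I; y \<in> I \<rbrakk> \<Longrightarrow> x \<oplus>\<^bsub>R\<^esub> y \<in> I"
    and "\<And>r x. \<lbrakk> r \<in> carrier R; x \<in> I \<rbrakk> \<Longrightarrow> x \<otimes>\<^bsub>R\<^esub> r \<in> I"
  shows "right_ideal I R"
  unfolding right_ideal_def
  by (rule right_module.submoduleI[OF right_module_regular[OF assms(1)]])
    (use assms(2-) in \<open>auto simp: regular_right_module_def\<close>)

lemma right_idealD:
  assumes "right_ideal I R"
  shows "I \<subseteq> carrier R" "\<zero>\<^bsub>R\<^esub> \<in> I"
    and "\<lbrakk> x \<in> I; y \<in> I \<rbrakk> \<Longrightarrow> x \<oplus>\<^bsub>R\<^esub> y \<in> I"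
    and "\<lbrakk> r \<in> carrier R; x \<in> I \<rbrakk> \<Longrightarrow> x \<otimes>\<^bsub>R\<^esub> r \<in> I"
  using submoduleD[OF assms[unfolded right_ideal_def]] by (auto simp: regular_right_module_def)

section \<open>Maximal submodules and the radical\<close>

definition maximal_submodule ::
  "'b set \<Rightarrow> ('a, 'r) ring_scheme \<Rightarrow> ('a, 'b, 'm) module_scheme \<Rightarrow> bool" where
  "maximal_submodule K R M \<longleftrightarrow>
     submodule K R M \<and> K \<noteq> carrier M \<and>
     (\<forall>L. submodule L R M \<and> K \<subseteq> L \<longrightarrow> L = K \<or> L = carrier M)"

definition module_radical ::
  "('a, 'r) ring_scheme \<Rightarrow> ('a, 'b, 'm) module_scheme \<Rightarrow> 'b set" where
  "module_radical R M = carrier M \<inter> \<Inter>{K. maximal_submodule K R M}"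

lemma maximal_right_ideal_iff:
  "maximal_right_ideal I R \<longleftrightarrow> maximal_submodule I R (regular_right_module R)"
  by (simp add: maximal_right_ideal_def maximal_submodule_def right_ideal_def
      regular_right_module_def)

lemma jacobson_radical_eq: "jacobson_radical R = module_radical R (regular_right_module R)"
  by (simp add: jacobson_radical_def module_radical_def maximal_right_ideal_iff)
    (simp add: regular_right_module_def)

context right_module
begin

lemma submodule_radical: "submodule (module_radical R M) R M"
proof (rule submoduleI)
  have sm: "submodule K R M" if "maximal_submodule K R M" for K
    using that by (simp add: maximal_submodule_def)
  show "module_radical R M \<subseteq> carrier M" by (auto simp: module_radical_def)
  show "\<zero>\<^bsub>M\<^esub> \<in> module_radical R M"
    using submoduleD(2)[OF sm] by (auto simp: module_radical_def)
  show "x \<oplus>\<^bsub>M\<^esub> y \<in> module_radical R M"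
    if "x \<in> module_radical R M" "y \<in> module_radical R M" for x y
    using that submoduleD(3)[OF sm] by (auto simp: module_radical_def)
  show "r \<odot>\<^bsub>M\<^esub> x \<in> module_radical R M"
    if "r \<in> carrier R" "x \<in> module_radical R M" for r x
    using that submoduleD(4)[OF sm] by (auto simp: module_radical_def)
qed

text \<open>If \<open>a\<close> is in a right ideal \<open>L\<close> above the annihilator and \<open>x \<cdot> a \<notin> K\<close>, then
  \<open>(x \<cdot> a) \<cdot> R + K = M\<close> by maximality of \<open>K\<close>.  Thus \<open>x = x \<cdot> (a r) + k\<close> with \<open>k \<in> K\<close>, so
  \<open>1 - a r\<close> annihilates \<open>x\<close> modulo \<open>K\<close>, and \<open>1 = a r + (1 - a r) \<in> L\<close>.\<close>

lemma maximal_right_ideal_annihilator: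
  assumes K: "maximal_submodule K R M" and x: "x \<in> carrier M" "x \<notin> K"
  shows "maximal_right_ideal {r \<in> carrier R. r \<odot>\<^bsub>M\<^esub> x \<in> K} R"
proof -
  let ?I = "{r \<in> carrier R. r \<odot>\<^bsub>M\<^esub> x \<in> K}"
  have smK: "submodule K R M" using K by (simp add: maximal_submodule_def)
  note K' = submoduleD[OF smK]
  have I: "right_ideal ?I R"
    by (rule right_idealI)
      (use R.ring_axioms x K' in \<open>auto simp: smult_l_distr smult_assoc\<close>)
  moreover have "?I \<noteq> carrier R" using x R.one_closed by force
  moreover have "L = ?I \<or> L = carrier R" if L: "right_ideal L R" and IL: "?I \<subseteq> L" for L
  proof (cases "L \<subseteq> ?I")
    case False
    note L' = right_idealD[OF L]
    from False obtain a where a: "a \<in> L" "a \<odot>\<^bsub>M\<^esub> x \<notin> K" using L'(1) by blast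
    then have aR: "a \<in> carrier R" using L'(1) by blast
    let ?C = "{r \<odot>\<^bsub>M\<^esub> (a \<odot>\<^bsub>M\<^esub> x) | r. r \<in> carrier R}"
    have ax: "a \<odot>\<^bsub>M\<^esub> x \<in> carrier M" using aR x by simp
    note C = submodule_cyclic[OF ax]
    have "submodule (?C <+>\<^bsub>M\<^esub> K) R M" by (rule submodule_add[OF C smK])
    moreover have "K \<subseteq> ?C <+>\<^bsub>M\<^esub> K" by (rule subset_set_add[OF C smK])
    moreover have "?C <+>\<^bsub>M\<^esub> K \<noteq> K"
      using subset_set_add(1)[OF C smK] mem_cyclic[OF ax] a(2) by blast
    ultimately have "?C <+>\<^bsub>M\<^esub> K = carrier M" using K by (auto simp: maximal_submodule_def)
    then obtain r k where r: "r \<in> carrier R" and k: "k \<in> K"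
      and xe: "x = r \<odot>\<^bsub>M\<^esub> (a \<odot>\<^bsub>M\<^esub> x) \<oplus>\<^bsub>M\<^esub> k"
      using x(1) unfolding mem_set_add_iff set_eq_iff by blast
    let ?s = "\<one>\<^bsub>R\<^esub> \<ominus>\<^bsub>R\<^esub> a \<otimes>\<^bsub>R\<^esub> r"
    have s: "?s \<in> carrier R" using aR r by simp
    have kM: "k \<in> carrier M" using k K'(1) by blast
    have one: "\<one>\<^bsub>R\<^esub> = a \<otimes>\<^bsub>R\<^esub> r \<oplus>\<^bsub>R\<^esub> ?s"
      using aR r by algebra
    have "x = (a \<otimes>\<^bsub>R\<^esub> r) \<odot>\<^bsub>M\<^esub> x \<oplus>\<^bsub>M\<^esub> ?s \<odot>\<^bsub>M\<^esub> x"
      using one smult_l_distr[of "a \<otimes>\<^bsub>R\<^esub> r" ?s x] s aR r x by simp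
    moreover have "x = (a \<otimes>\<^bsub>R\<^esub> r) \<odot>\<^bsub>M\<^esub> x \<oplus>\<^bsub>M\<^esub> k" using xe smult_assoc aR r x by simp
    ultimately have "?s \<odot>\<^bsub>M\<^esub> x = k"
      using s aR r x kM by (metis M.a_comm M.add.right_cancel R.m_closed smult_closed)
    then have "?s \<in> L" using IL s k by blast
    then have "\<one>\<^bsub>R\<^esub> \<in> L" using one L'(3) L'(4)[OF r a(1)] by metis
    then have "carrier R \<subseteq> L" using L'(4) by fastforce
    then show ?thesis using L'(1) by blast
  qed (use IL in blast)
  ultimately show ?thesis by (auto simp: maximal_right_ideal_def)
qed

lemma smult_radical:
  assumes j: "j \<in> jacobson_radical R" and x: "x \<in> carrier M"
  shows "j \<odot>\<^bsub>M\<^esub> x \<in> module_radical R M"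
proof -
  have jR: "j \<in> carrier R" using j by (simp add: jacobson_radical_def)
  have "j \<odot>\<^bsub>M\<^esub> x \<in> K" if K: "maximal_submodule K R M" for K
  proof (cases "x \<in> K")
    case True
    then show ?thesis
      using submoduleD(4)[of K R M j x] K jR by (simp add: maximal_submodule_def)
  next
    case False
    show ?thesis using maximal_right_ideal_annihilator[OF K x False] j
      by (auto simp: jacobson_radical_def)
  qed
  then show ?thesis using jR x by (auto simp: module_radical_def)
qed

text \<open>Finite generation is what makes Zorn's lemma applicable: if the union of a chain of proper
  submodules contained the finitely many generators, so would one member of the chain.\<close>

lemma exists_maximal_submodule:
  assumes fg: "finitely_generated R M" and X: "submodule X R M" "X \<noteq> carrier M"
  obtains K where "maximal_submodule K R M" "X \<subseteq> K"
proof -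
  obtain S where S: "finite S" "S \<subseteq> carrier M"
    "\<forall>N. submodule N R M \<and> S \<subseteq> N \<longrightarrow> N = carrier M"
    using fg unfolding finitely_generated_def by (elim exE conjE)
  let ?A = "{L. submodule L R M \<and> X \<subseteq> L \<and> L \<noteq> carrier M}"
  have "\<exists>K\<in>?A. \<forall>L\<in>?A. K \<subseteq> L \<longrightarrow> L = K"
  proof (rule subset_Zorn)
    fix C assume ch: "subset.chain ?A C"
    show "\<exists>U\<in>?A. \<forall>L\<in>C. L \<subseteq> U"
    proof (cases "C = {}")
      case True
      then show ?thesis using X by blast
    next
      case False
      have CA: "C \<subseteq> ?A" using ch by (simp add: subset_chain_def)
      have "submodule (\<Union>C) R M"
        by (rule submodule_Union_chain[OF ch False]) (use CA in blast)
      moreover have "\<Union>C \<noteq> carrier M"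
      proof
        assume "\<Union>C = carrier M"
        then obtain L where "L \<in> C" "S \<subseteq> L"
          using finite_subset_Union_chain[OF S(1) _ False ch] S(2) by blast
        then show False using S(3) CA by blast
      qed
      ultimately show ?thesis using False CA by (intro bexI[of _ "\<Union>C"]) auto
    qed
  qed
  then obtain K where "K \<in> ?A" "\<forall>L\<in>?A. K \<subseteq> L \<longrightarrow> L = K" by blast
  then have "maximal_submodule K R M" "X \<subseteq> K" by (auto simp: maximal_submodule_def)
  then show thesis by (rule that)
qed

text \<open>Nakayama's lemma, with \<open>Rad M\<close> in place of \<open>M \<cdot> J\<close>.\<close>

lemma radical_superfluous:
  assumes fg: "finitely_generated R M" and X: "submodule X R M"
    and sum: "X <+>\<^bsub>M\<^esub> module_radical R M = carrier M"
  shows "X = carrier M"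
proof (rule ccontr)
  assume "X \<noteq> carrier M"
  then obtain K where K: "maximal_submodule K R M" "X \<subseteq> K"
    using exists_maximal_submodule[OF fg X] by blast
  then have sm: "submodule K R M" by (simp add: maximal_submodule_def)
  have "module_radical R M \<subseteq> K" using K(1) by (auto simp: module_radical_def)
  then have "carrier M \<subseteq> K" using set_add_least[OF sm K(2)] sum by blast
  then show False using K(1) submoduleD(1)[OF sm] by (auto simp: maximal_submodule_def)
qed

end

text \<open>The radical of the right module \<open>R\<close> is closed under multiplication from the left because
  \<open>x \<cdot> J \<subseteq> Rad R = J\<close>, which is \<open>smult_radical\<close> for \<open>M = R\<close>.\<close>

lemma ideal_jacobson_radical:
  assumes "ring R" shows "ideal (jacobson_radical R) R"
proof -
  interpret reg: right_module R "regular_right_module R" by (rule right_module_regular) fact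
  have "right_ideal (jacobson_radical R) R"
    using reg.submodule_radical by (simp add: right_ideal_def jacobson_radical_eq)
  note J = right_idealD[OF this]
  show ?thesis
  proof (rule idealI)
    show "subgroup (jacobson_radical R) (add_monoid R)"
    proof (rule subgroup.intro)
      fix x assume x: "x \<in> jacobson_radical R"
      then have xR: "x \<in> carrier R" using J(1) by blast
      have "x \<otimes>\<^bsub>R\<^esub> (\<ominus>\<^bsub>R\<^esub> \<one>\<^bsub>R\<^esub>) \<in> jacobson_radical R" using J(4) x by simp
      then show "inv\<^bsub>add_monoid R\<^esub> x \<in> jacobson_radical R"
        using xR by (simp add: reg.R.r_minus a_inv_def[symmetric])
    qed (use J in auto)
  next
    fix a x assume "a \<in> jacobson_radical R" "x \<in> carrier R"
    then show "x \<otimes>\<^bsub>R\<^esub> a \<in> jacobson_radical R"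
      using reg.smult_radical[of a x] jacobson_radical_eq[of R]
      by (simp add: regular_right_module_def)
  qed (use J assms in auto)
qed

section \<open>Finiteness modulo the radical\<close>

text \<open>Every right ideal \<open>I\<close> above \<open>J\<close> equals \<open>e R + J\<close>.  A complement of \<open>I / J\<close> in \<open>R / J\<close> splits
  \<open>1\<close> as \<open>e + k\<close> modulo \<open>J\<close>.  For \<open>x \<in> I\<close> the class of \<open>x - e x = k x\<close> then lies both in \<open>I / J\<close>
  and in the complement, so it vanishes.\<close>

lemma semilocal_right_ideal_principal:
  assumes R: "semilocal_ring R" and I: "right_ideal I R" and JI: "jacobson_radical R \<subseteq> I"
  shows "\<exists>e\<in>I. \<forall>x\<in>I. x \<ominus>\<^bsub>R\<^esub> e \<otimes>\<^bsub>R\<^esub> x \<in> jacobson_radical R"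
proof -
  define J where "J = jacobson_radical R"
  interpret R: ring R using R by (simp add: semilocal_ring_def)
  interpret J: ideal J R unfolding J_def by (rule ideal_jacobson_radical) (rule R.ring_axioms)
  let ?Q = "R Quot J"
  let ?B = "regular_right_module ?Q"
  interpret B: right_module ?Q ?B by (rule right_module_regular) (rule J.quotient_is_ring)
  note I' = right_idealD[OF I]
  have eqs: "carrier ?B = a_rcosets\<^bsub>R\<^esub> J" "zero ?B = J" "add ?B = set_add R"
      "smult ?B = (\<lambda>r x. rcoset_mult R J x r)" "carrier ?Q = a_rcosets\<^bsub>R\<^esub> J"
    by (simp_all add: regular_right_module_def FactRing_def)
  have cosE: "\<exists>a\<in>carrier R. X = J +>\<^bsub>R\<^esub> a" if "X \<in> a_rcosets\<^bsub>R\<^esub> J" for X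
    using that by (auto simp: A_RCOSETS_def' a_r_coset_def')
  have cosI: "J +>\<^bsub>R\<^esub> a \<in> a_rcosets\<^bsub>R\<^esub> J" if "a \<in> carrier R" for a
    using that by (rule R.a_rcosetsI[OF J.a_subset])
  let ?K = "(\<lambda>x. J +>\<^bsub>R\<^esub> x) ` I"
  have J0: "J +>\<^bsub>R\<^esub> \<zero>\<^bsub>R\<^esub> = J" by (rule R.a_coset_add_zero[OF J.a_subset])
  have mem: "x \<in> J" if "x \<in> carrier R" "J +>\<^bsub>R\<^esub> x = J" for x
    using J.a_rcos_self[OF that(1)] that(2) by simp
  have "submodule ?K ?Q ?B"
  proof (rule B.submoduleI, unfold eqs)
    show "?K \<subseteq> a_rcosets\<^bsub>R\<^esub> J" using I'(1) cosI by blast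
    show "J \<in> ?K" using I'(2) J0 by force
  next
    fix X Y assume "X \<in> ?K" "Y \<in> ?K"
    then obtain x y where "x \<in> I" "X = J +>\<^bsub>R\<^esub> x" "y \<in> I" "Y = J +>\<^bsub>R\<^esub> y" by blast
    then show "X <+>\<^bsub>R\<^esub> Y \<in> ?K" using I'(1,3) by (auto simp: J.a_rcos_sum subset_iff)
  next
    fix X Y assume "X \<in> a_rcosets\<^bsub>R\<^esub> J" "Y \<in> ?K"
    then obtain x y where "x \<in> carrier R" "X = J +>\<^bsub>R\<^esub> x" "y \<in> I" "Y = J +>\<^bsub>R\<^esub> y"
      using cosE by blast
    then show "rcoset_mult R J Y X \<in> ?K"
      using I'(1,4) by (auto simp: J.rcoset_mult_add subset_iff)
  qed
  then obtain N where "internal_direct_sum ?Q ?B ?K N"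
    using R unfolding semilocal_ring_def semisimple_ring_def semisimple_right_module_def J_def
    by blast
  then have N: "submodule N ?Q ?B" and sum: "?K <+>\<^bsub>?B\<^esub> N = a_rcosets\<^bsub>R\<^esub> J"
    and int: "?K \<inter> N = {J}"
    unfolding internal_direct_sum_def eqs by simp_all
  note N' = submoduleD[OF N, unfolded eqs]
  have "J +>\<^bsub>R\<^esub> \<one>\<^bsub>R\<^esub> \<in> ?K <+>\<^bsub>?B\<^esub> N" unfolding sum by (rule cosI) simp
  then obtain e Z where e: "e \<in> I" and Z: "Z \<in> N"
    and one: "J +>\<^bsub>R\<^esub> \<one>\<^bsub>R\<^esub> = (J +>\<^bsub>R\<^esub> e) <+>\<^bsub>R\<^esub> Z"
    unfolding mem_set_add_iff eqs by blast
  obtain k where k: "k \<in> carrier R" and Zk: "Z = J +>\<^bsub>R\<^esub> k" using cosE Z N'(1) by blast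
  have eR: "e \<in> carrier R" using e I'(1) by blast
  have "J +>\<^bsub>R\<^esub> \<one>\<^bsub>R\<^esub> = J +>\<^bsub>R\<^esub> (e \<oplus>\<^bsub>R\<^esub> k)" using one eR k Zk by (simp add: J.a_rcos_sum)
  then have dec: "J +>\<^bsub>R\<^esub> x = (J +>\<^bsub>R\<^esub> (e \<otimes>\<^bsub>R\<^esub> x)) <+>\<^bsub>R\<^esub> (J +>\<^bsub>R\<^esub> (k \<otimes>\<^bsub>R\<^esub> x))"
    if "x \<in> carrier R" for x
    using J.rcoset_mult_add[of "\<one>\<^bsub>R\<^esub>" x] J.rcoset_mult_add[of "e \<oplus>\<^bsub>R\<^esub> k" x] that eR k
    by (simp add: J.a_rcos_sum R.l_distr)
  have "x \<ominus>\<^bsub>R\<^esub> e \<otimes>\<^bsub>R\<^esub> x \<in> J" if x: "x \<in> I" for x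
  proof -
    have xR: "x \<in> carrier R" using x I'(1) by blast
    have exI: "e \<otimes>\<^bsub>R\<^esub> x \<in> I" using I'(4) e xR by blast
    have m: "x \<ominus>\<^bsub>R\<^esub> e \<otimes>\<^bsub>R\<^esub> x \<in> I"
    proof -
      have "x \<oplus>\<^bsub>R\<^esub> (e \<otimes>\<^bsub>R\<^esub> x) \<otimes>\<^bsub>R\<^esub> (\<ominus>\<^bsub>R\<^esub> \<one>\<^bsub>R\<^esub>) \<in> I" using I'(3,4) x exI by simp
      then show ?thesis using xR eR by (simp add: R.r_minus a_minus_def)
    qed
    have "J +>\<^bsub>R\<^esub> (x \<ominus>\<^bsub>R\<^esub> e \<otimes>\<^bsub>R\<^esub> x) = (J +>\<^bsub>R\<^esub> x) <+>\<^bsub>R\<^esub> (J +>\<^bsub>R\<^esub> (\<ominus>\<^bsub>R\<^esub> (e \<otimes>\<^bsub>R\<^esub> x)))"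
      using xR eR by (simp add: J.a_rcos_sum a_minus_def)
    also have "\<dots> = J +>\<^bsub>R\<^esub> (e \<otimes>\<^bsub>R\<^esub> x \<oplus>\<^bsub>R\<^esub> k \<otimes>\<^bsub>R\<^esub> x \<oplus>\<^bsub>R\<^esub> \<ominus>\<^bsub>R\<^esub> (e \<otimes>\<^bsub>R\<^esub> x))"
      using dec[OF xR] xR eR k by (simp add: J.a_rcos_sum)
    also have "e \<otimes>\<^bsub>R\<^esub> x \<oplus>\<^bsub>R\<^esub> k \<otimes>\<^bsub>R\<^esub> x \<oplus>\<^bsub>R\<^esub> \<ominus>\<^bsub>R\<^esub> (e \<otimes>\<^bsub>R\<^esub> x) = k \<otimes>\<^bsub>R\<^esub> x"
      using xR eR k by algebra
    also have "J +>\<^bsub>R\<^esub> (k \<otimes>\<^bsub>R\<^esub> x) \<in> N"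
      using N'(4)[OF cosI[OF xR] Z] xR k by (simp add: Zk J.rcoset_mult_add)
    finally have "J +>\<^bsub>R\<^esub> (x \<ominus>\<^bsub>R\<^esub> e \<otimes>\<^bsub>R\<^esub> x) \<in> ?K \<inter> N" using m by blast
    then show ?thesis using int mem xR eR by simp
  qed
  then show ?thesis using e by (auto simp: J_def)
qed

text \<open>The quotient \<open>W / D\<close> is noetherian, expressed without forming it: each submodule between \<open>D\<close>
  and \<open>W\<close> is generated by \<open>D\<close> and finitely many elements.\<close>

definition noetherian_over ::
  "('a, 'r) ring_scheme \<Rightarrow> ('a, 'b, 'm) module_scheme \<Rightarrow> 'b set \<Rightarrow> 'b set \<Rightarrow> bool" where
  "noetherian_over R M D W \<longleftrightarrow>
     (\<forall>L. submodule L R M \<and> D \<subseteq> L \<and> L \<subseteq> W \<longrightarrow>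
        (\<exists>T. finite T \<and> T \<subseteq> L \<and>
           (\<forall>N. submodule N R M \<and> D \<subseteq> N \<and> T \<subseteq> N \<longrightarrow> L \<subseteq> N)))"

context right_module
begin

text \<open>Let \<open>L \<subseteq> m \<cdot> R + W\<close>.  The coefficients of \<open>m\<close> occurring in elements of \<open>L\<close> form a right ideal
  above \<open>J\<close>, hence one of the form \<open>e R + J\<close>.  One element \<open>l = m \<cdot> e + w0\<close> of \<open>L\<close> with coefficient
  \<open>e\<close> is enough to reduce every element of \<open>L\<close> to \<open>L \<inter> W\<close>, as \<open>M \<cdot> J \<subseteq> D \<subseteq> W\<close>; and \<open>L \<inter> W\<close> is
  generated by \<open>D\<close> and finitely many elements.\<close>

lemma noetherian_over_add_cyclic:
  assumes R: "semilocal_ring R"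
    and JD: "\<And>j x. \<lbrakk> j \<in> jacobson_radical R; x \<in> carrier M \<rbrakk> \<Longrightarrow> j \<odot>\<^bsub>M\<^esub> x \<in> D"
    and W: "submodule W R M" "D \<subseteq> W" and noeth: "noetherian_over R M D W"
    and m: "m \<in> carrier M"
  shows "noetherian_over R M D ({r \<odot>\<^bsub>M\<^esub> m | r. r \<in> carrier R} <+>\<^bsub>M\<^esub> W)"
  unfolding noetherian_over_def
proof (intro allI impI, elim conjE)
  fix L assume L: "submodule L R M" "D \<subseteq> L"
    and LW: "L \<subseteq> {r \<odot>\<^bsub>M\<^esub> m | r. r \<in> carrier R} <+>\<^bsub>M\<^esub> W"
  note L' = submoduleD[OF L(1)] and W' = submoduleD[OF W(1)]
  note WM = W'(1)[THEN subsetD] and LM = L'(1)[THEN subsetD]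
  let ?I = "{r \<in> carrier R. \<exists>w\<in>W. r \<odot>\<^bsub>M\<^esub> m \<oplus>\<^bsub>M\<^esub> w \<in> L}"
  have I: "right_ideal ?I R"
  proof (rule right_idealI)
    show "\<zero>\<^bsub>R\<^esub> \<in> ?I" using L'(2) W'(2) m by force
  next
    fix x y assume "x \<in> ?I" "y \<in> ?I"
    then obtain v w where x: "x \<in> carrier R" "v \<in> W" "x \<odot>\<^bsub>M\<^esub> m \<oplus>\<^bsub>M\<^esub> v \<in> L"
      and y: "y \<in> carrier R" "w \<in> W" "y \<odot>\<^bsub>M\<^esub> m \<oplus>\<^bsub>M\<^esub> w \<in> L" by blast
    have "(x \<oplus>\<^bsub>R\<^esub> y) \<odot>\<^bsub>M\<^esub> m \<oplus>\<^bsub>M\<^esub> (v \<oplus>\<^bsub>M\<^esub> w) =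
        (x \<odot>\<^bsub>M\<^esub> m \<oplus>\<^bsub>M\<^esub> v) \<oplus>\<^bsub>M\<^esub> (y \<odot>\<^bsub>M\<^esub> m \<oplus>\<^bsub>M\<^esub> w)"
      using x y m WM by (simp add: smult_l_distr M.a_ac)
    also have "\<dots> \<in> L" using L'(3) x y by blast
    finally show "x \<oplus>\<^bsub>R\<^esub> y \<in> ?I" using x y W'(3) by blast
  next
    fix r x assume r: "r \<in> carrier R" and "x \<in> ?I"
    then obtain v where x: "x \<in> carrier R" "v \<in> W" "x \<odot>\<^bsub>M\<^esub> m \<oplus>\<^bsub>M\<^esub> v \<in> L" by blast
    have "(x \<otimes>\<^bsub>R\<^esub> r) \<odot>\<^bsub>M\<^esub> m \<oplus>\<^bsub>M\<^esub> r \<odot>\<^bsub>M\<^esub> v = r \<odot>\<^bsub>M\<^esub> (x \<odot>\<^bsub>M\<^esub> m \<oplus>\<^bsub>M\<^esub> v)"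
      using x r m WM by (simp add: smult_r_distr smult_assoc)
    also have "\<dots> \<in> L" using L'(4) x r by blast
    finally show "x \<otimes>\<^bsub>R\<^esub> r \<in> ?I" using x r W'(4) by blast
  qed (use R.ring_axioms in auto)
  have JI: "jacobson_radical R \<subseteq> ?I"
  proof
    fix j assume j: "j \<in> jacobson_radical R"
    then have "j \<in> carrier R" by (simp add: jacobson_radical_def)
    moreover have "j \<odot>\<^bsub>M\<^esub> m \<oplus>\<^bsub>M\<^esub> \<zero>\<^bsub>M\<^esub> \<in> L" using JD[OF j m] L(2) LM by auto
    ultimately show "j \<in> ?I" using W'(2) by blast
  qed
  obtain e where e: "e \<in> ?I" and eJ: "\<And>x. x \<in> ?I \<Longrightarrow> x \<ominus>\<^bsub>R\<^esub> e \<otimes>\<^bsub>R\<^esub> x \<in> jacobson_radical R"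
    using semilocal_right_ideal_principal[OF R I JI] by (elim bexE) blast
  then obtain w0 where eR: "e \<in> carrier R" and w0: "w0 \<in> W" and l: "e \<odot>\<^bsub>M\<^esub> m \<oplus>\<^bsub>M\<^esub> w0 \<in> L"
    by blast
  let ?l = "e \<odot>\<^bsub>M\<^esub> m \<oplus>\<^bsub>M\<^esub> w0"
  have "submodule (L \<inter> W) R M" by (rule submodule_Int[OF L(1) W(1)])
  then obtain T where T: "finite T" "T \<subseteq> L \<inter> W"
    "\<And>N. submodule N R M \<Longrightarrow> D \<subseteq> N \<Longrightarrow> T \<subseteq> N \<Longrightarrow> L \<inter> W \<subseteq> N"
    using noeth L(2) W(2) unfolding noetherian_over_def by (metis Int_greatest Int_lower2)
  have "L \<subseteq> N" if N: "submodule N R M" "D \<subseteq> N" "insert ?l T \<subseteq> N" for N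
  proof
    fix x assume x: "x \<in> L"
    then obtain r w where r: "r \<in> carrier R" and w: "w \<in> W" and xe: "x = r \<odot>\<^bsub>M\<^esub> m \<oplus>\<^bsub>M\<^esub> w"
      using LW unfolding subset_iff mem_set_add_iff by blast
    let ?j = "r \<ominus>\<^bsub>R\<^esub> e \<otimes>\<^bsub>R\<^esub> r"
    have "r \<in> ?I" using r w x xe by blast
    then have j: "?j \<in> jacobson_radical R" by (rule eJ)
    have jR: "?j \<in> carrier R" using r eR by simp
    \<comment> \<open>This is \<open>x - l \<cdot> r\<close>, written so that membership in \<open>W\<close> is evident.\<close>
    define z where "z = ?j \<odot>\<^bsub>M\<^esub> m \<oplus>\<^bsub>M\<^esub> (w \<ominus>\<^bsub>M\<^esub> r \<odot>\<^bsub>M\<^esub> w0)"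
    have zW: "z \<in> W" unfolding z_def
      using JD[OF j m] W(2) W'(3) submodule_minus[OF W(1) w W'(4)[OF r w0]] by blast
    have "r = ?j \<oplus>\<^bsub>R\<^esub> e \<otimes>\<^bsub>R\<^esub> r" using r eR by algebra
    then have rm: "r \<odot>\<^bsub>M\<^esub> m = ?j \<odot>\<^bsub>M\<^esub> m \<oplus>\<^bsub>M\<^esub> r \<odot>\<^bsub>M\<^esub> (e \<odot>\<^bsub>M\<^esub> m)"
      using r eR jR m smult_l_distr[of ?j "e \<otimes>\<^bsub>R\<^esub> r" m] by (simp add: smult_assoc)
    have we: "w = (w \<ominus>\<^bsub>M\<^esub> r \<odot>\<^bsub>M\<^esub> w0) \<oplus>\<^bsub>M\<^esub> r \<odot>\<^bsub>M\<^esub> w0"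
      using WM w w0 r by (simp add: a_minus_def M.a_assoc M.l_neg)
    have ac: "(a \<oplus>\<^bsub>M\<^esub> b) \<oplus>\<^bsub>M\<^esub> (c \<oplus>\<^bsub>M\<^esub> d) = (a \<oplus>\<^bsub>M\<^esub> c) \<oplus>\<^bsub>M\<^esub> (b \<oplus>\<^bsub>M\<^esub> d)"
      if "a \<in> carrier M" "b \<in> carrier M" "c \<in> carrier M" "d \<in> carrier M" for a b c d
      using that by (simp add: M.a_ac)
    have "x = (?j \<odot>\<^bsub>M\<^esub> m \<oplus>\<^bsub>M\<^esub> r \<odot>\<^bsub>M\<^esub> (e \<odot>\<^bsub>M\<^esub> m)) \<oplus>\<^bsub>M\<^esub>
        ((w \<ominus>\<^bsub>M\<^esub> r \<odot>\<^bsub>M\<^esub> w0) \<oplus>\<^bsub>M\<^esub> r \<odot>\<^bsub>M\<^esub> w0)"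
      unfolding xe by (rule arg_cong2[OF rm we])
    also have "\<dots> = z \<oplus>\<^bsub>M\<^esub> (r \<odot>\<^bsub>M\<^esub> (e \<odot>\<^bsub>M\<^esub> m) \<oplus>\<^bsub>M\<^esub> r \<odot>\<^bsub>M\<^esub> w0)"
      unfolding z_def by (rule ac) (use r eR jR m WM[OF w0] WM[OF w] in simp_all)
    finally have "x = z \<oplus>\<^bsub>M\<^esub> (r \<odot>\<^bsub>M\<^esub> (e \<odot>\<^bsub>M\<^esub> m) \<oplus>\<^bsub>M\<^esub> r \<odot>\<^bsub>M\<^esub> w0)" .
    then have xz: "x = z \<oplus>\<^bsub>M\<^esub> r \<odot>\<^bsub>M\<^esub> ?l" using r eR m WM[OF w0] by (simp add: smult_r_distr)
    have zM: "z \<in> carrier M" and rl: "r \<odot>\<^bsub>M\<^esub> ?l \<in> L" and rlM: "r \<odot>\<^bsub>M\<^esub> ?l \<in> carrier M"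
      using zW WM L'(4)[OF r l] LM by auto
    have "x \<ominus>\<^bsub>M\<^esub> r \<odot>\<^bsub>M\<^esub> ?l = z" using xz zM rlM by (simp add: a_minus_def M.a_assoc M.r_neg)
    then have "z \<in> L \<inter> W" using zW submodule_minus[OF L(1) x rl] by simp
    then have "z \<in> N" using T(3) N by blast
    moreover have "r \<odot>\<^bsub>M\<^esub> ?l \<in> N" using submoduleD(4)[OF N(1) r] N(3) by blast
    ultimately show "x \<in> N" using xz submoduleD(3)[OF N(1)] by simp
  qed
  then show "\<exists>T. finite T \<and> T \<subseteq> L \<and>
      (\<forall>N. submodule N R M \<and> D \<subseteq> N \<and> T \<subseteq> N \<longrightarrow> L \<subseteq> N)"
    using T(1,2) l by (intro exI[of _ "insert ?l T"]) auto
qed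

lemma noetherian_over_radical:
  assumes R: "semilocal_ring R" and fg: "finitely_generated R M"
  shows "noetherian_over R M (module_radical R M) (carrier M)"
proof -
  let ?D = "module_radical R M"
  obtain S where S: "finite S" "S \<subseteq> carrier M"
    "\<forall>N. submodule N R M \<and> S \<subseteq> N \<longrightarrow> N = carrier M"
    using fg unfolding finitely_generated_def by (elim exE conjE)
  have "\<exists>W. submodule W R M \<and> ?D \<subseteq> W \<and> S \<subseteq> W \<and> noetherian_over R M ?D W"
    using S(1,2)
  proof (induction rule: finite_induct)
    case empty
    have "noetherian_over R M ?D ?D"
      unfolding noetherian_over_def by (intro allI impI exI[of _ "{}"]) auto
    then show ?case using submodule_radical by blast
  next
    case (insert m S)
    then obtain W where W: "submodule W R M" "?D \<subseteq> W" "S \<subseteq> W" "noetherian_over R M ?D W"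
      by auto
    let ?C = "{r \<odot>\<^bsub>M\<^esub> m | r. r \<in> carrier R}"
    have m: "m \<in> carrier M" using insert.prems by simp
    note C = submodule_cyclic[OF m]
    have "noetherian_over R M ?D (?C <+>\<^bsub>M\<^esub> W)"
      by (rule noetherian_over_add_cyclic[OF R smult_radical W(1,2,4) m])
    moreover have "?D \<subseteq> ?C <+>\<^bsub>M\<^esub> W" "insert m S \<subseteq> ?C <+>\<^bsub>M\<^esub> W"
      using subset_set_add[OF C W(1)] mem_cyclic[OF m] W(2,3) by blast+
    ultimately show ?case using submodule_add[OF C W(1)] by blast
  qed
  then show ?thesis using S(3) by blast
qed

text \<open>The union of a chain in \<open>F\<close> is generated by \<open>D\<close> and finitely many elements, which already lie
  in one member of the chain; so that member is the union.\<close>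

lemma noetherian_over_maximal:
  assumes noeth: "noetherian_over R M D (carrier M)"
    and ne: "F \<noteq> {}" and F: "\<And>L. L \<in> F \<Longrightarrow> submodule L R M \<and> D \<subseteq> L"
  shows "\<exists>L\<in>F. \<forall>L'\<in>F. L \<subseteq> L' \<longrightarrow> L' = L"
proof (rule subset_Zorn)
  fix C assume ch: "subset.chain F C"
  show "\<exists>U\<in>F. \<forall>L\<in>C. L \<subseteq> U"
  proof (cases "C = {}")
    case True
    then show ?thesis using ne by blast
  next
    case False
    have CF: "C \<subseteq> F" using ch by (simp add: subset_chain_def)
    have sm: "submodule (\<Union>C) R M"
      by (rule submodule_Union_chain[OF ch False]) (use CF F in blast)
    have "D \<subseteq> \<Union>C" using False CF F by blast
    then have "\<exists>T. finite T \<and> T \<subseteq> \<Union>C \<and>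
        (\<forall>N. submodule N R M \<and> D \<subseteq> N \<and> T \<subseteq> N \<longrightarrow> \<Union>C \<subseteq> N)"
      using noeth[unfolded noetherian_over_def, rule_format, of "\<Union>C"] sm submoduleD(1)[OF sm]
      by simp
    then obtain T where T: "finite T" "T \<subseteq> \<Union>C"
      "\<forall>N. submodule N R M \<and> D \<subseteq> N \<and> T \<subseteq> N \<longrightarrow> \<Union>C \<subseteq> N"
      by (elim exE conjE)
    obtain L where "L \<in> C" "T \<subseteq> L" by (rule finite_subset_Union_chain[OF T(1,2) False ch])
    then show ?thesis using T(3) CF F by blast
  qed
qed

end

section \<open>Direct sums of projective submodules\<close>

context right_module
begin

lemma projective_zero: "projective_right_module R (M\<lparr>carrier := {\<zero>\<^bsub>M\<^esub>}\<rparr>)"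
proof -
  let ?Z = "M\<lparr>carrier := {\<zero>\<^bsub>M\<^esub>}\<rparr>"
  have Z: "right_module R ?Z" by (rule right_module_submodule[OF submodule_zero])
  have "lifting_property R ?Z A B" if A: "right_module R A" and B: "right_module R B"
    for A :: "('a, 'b \<Rightarrow> 'a) module" and B :: "('a, 'b) module"
    unfolding lifting_property_def
  proof (intro allI impI, elim conjE)
    fix f g assume f: "f \<in> right_module_hom R A B" and g: "g \<in> right_module_hom R ?Z B"
    interpret A: right_module R A by fact
    have "f \<zero>\<^bsub>A\<^esub> = g \<zero>\<^bsub>M\<^esub>"
      using right_module_hom_zero[OF A B f] right_module_hom_zero[OF Z B g] by simp
    moreover have "(\<lambda>x. \<zero>\<^bsub>A\<^esub>) \<in> right_module_hom R ?Z A" by (rule right_module_homI) auto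
    ultimately show "\<exists>h\<in>right_module_hom R ?Z A. \<forall>x\<in>carrier ?Z. f (h x) = g x"
      by (intro bexI[of _ "\<lambda>x. \<zero>\<^bsub>A\<^esub>"]) auto
  qed
  then show ?thesis using Z by (simp add: projective_right_module_def)
qed

lemma direct_sum_unique:
  assumes P: "submodule P R M" and Q: "submodule Q R M" and PQ: "P \<inter> Q = {\<zero>\<^bsub>M\<^esub>}"
    and mem: "a \<in> P" "b \<in> P" "c \<in> Q" "d \<in> Q" and eq: "a \<oplus>\<^bsub>M\<^esub> c = b \<oplus>\<^bsub>M\<^esub> d"
  shows "a = b" "c = d"
proof -
  have cl: "a \<in> carrier M" "b \<in> carrier M" "c \<in> carrier M" "d \<in> carrier M"
    using mem submoduleD(1)[OF P] submoduleD(1)[OF Q] by auto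
  have cancel: "x \<oplus>\<^bsub>M\<^esub> y \<ominus>\<^bsub>M\<^esub> y = x" if "x \<in> carrier M" "y \<in> carrier M" for x y
    using that by (simp add: a_minus_def M.a_assoc M.r_neg)
  have a: "a = (d \<ominus>\<^bsub>M\<^esub> c) \<oplus>\<^bsub>M\<^esub> b"
    using cancel[of a c] cl unfolding eq by (simp add: a_minus_def M.a_ac)
  then have ab: "a \<ominus>\<^bsub>M\<^esub> b = d \<ominus>\<^bsub>M\<^esub> c" using cancel[of "d \<ominus>\<^bsub>M\<^esub> c" b] cl by simp
  then have "a \<ominus>\<^bsub>M\<^esub> b \<in> P \<inter> Q"
    using submodule_minus[OF P] submodule_minus[OF Q] mem by (metis IntI)
  then have "a \<ominus>\<^bsub>M\<^esub> b = \<zero>\<^bsub>M\<^esub>" using PQ by blast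
  then show "a = b" using a ab cl by simp
  with eq cl show "c = d" by (metis M.a_comm M.add.right_cancel)
qed

text \<open>A homomorphism on \<open>P \<oplus> Q\<close> is lifted by lifting its restrictions to \<open>P\<close> and \<open>Q\<close> and adding
  the lifts along the projections \<open>p\<close> and \<open>q\<close>.\<close>

lemma projective_add:
  assumes P: "submodule P R M" and Q: "submodule Q R M" and PQ: "P \<inter> Q = {\<zero>\<^bsub>M\<^esub>}"
    and projP: "projective_right_module R (M\<lparr>carrier := P\<rparr>)"
    and projQ: "projective_right_module R (M\<lparr>carrier := Q\<rparr>)"
  shows "projective_right_module R (M\<lparr>carrier := P <+>\<^bsub>M\<^esub> Q\<rparr>)"
proof -
  let ?S = "P <+>\<^bsub>M\<^esub> Q"
  let ?M = "M\<lparr>carrier := ?S\<rparr>"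
  have S: "submodule ?S R M" by (rule submodule_add[OF P Q])
  note subs = subset_set_add[OF P Q]
  note PM = submoduleD(1)[OF P, THEN subsetD] and QM = submoduleD(1)[OF Q, THEN subsetD]
  have "\<exists>a b. a \<in> P \<and> b \<in> Q \<and> z = a \<oplus>\<^bsub>M\<^esub> b" if "z \<in> ?S" for z
    using that unfolding mem_set_add_iff by blast
  then obtain p q where pq: "\<And>z. z \<in> ?S \<Longrightarrow> p z \<in> P" "\<And>z. z \<in> ?S \<Longrightarrow> q z \<in> Q"
    "\<And>z. z \<in> ?S \<Longrightarrow> z = p z \<oplus>\<^bsub>M\<^esub> q z" by metis
  have pqI: "p z = a \<and> q z = b" if "a \<in> P" "b \<in> Q" "z = a \<oplus>\<^bsub>M\<^esub> b" for z a b
  proof -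
    have z: "z \<in> ?S" using that unfolding mem_set_add_iff by blast
    then show ?thesis
      using direct_sum_unique[OF P Q PQ pq(1)[OF z] that(1) pq(2)[OF z] that(2)] pq(3)[OF z] that(3)
      by simp
  qed
  have pq_add: "p (y \<oplus>\<^bsub>M\<^esub> z) = p y \<oplus>\<^bsub>M\<^esub> p z \<and> q (y \<oplus>\<^bsub>M\<^esub> z) = q y \<oplus>\<^bsub>M\<^esub> q z"
    if y: "y \<in> ?S" and z: "z \<in> ?S" for y z
  proof (rule pqI)
    have "y \<oplus>\<^bsub>M\<^esub> z = (p y \<oplus>\<^bsub>M\<^esub> q y) \<oplus>\<^bsub>M\<^esub> (p z \<oplus>\<^bsub>M\<^esub> q z)" using pq(3) y z by metis
    also have "\<dots> = p y \<oplus>\<^bsub>M\<^esub> p z \<oplus>\<^bsub>M\<^esub> (q y \<oplus>\<^bsub>M\<^esub> q z)"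
      using pq(1,2)[OF y] pq(1,2)[OF z] PM QM by (simp add: M.a_ac)
    finally show "y \<oplus>\<^bsub>M\<^esub> z = p y \<oplus>\<^bsub>M\<^esub> p z \<oplus>\<^bsub>M\<^esub> (q y \<oplus>\<^bsub>M\<^esub> q z)" .
  qed (use submoduleD(3)[OF P] submoduleD(3)[OF Q] pq y z in auto)
  have pq_smult: "p (r \<odot>\<^bsub>M\<^esub> z) = r \<odot>\<^bsub>M\<^esub> p z \<and> q (r \<odot>\<^bsub>M\<^esub> z) = r \<odot>\<^bsub>M\<^esub> q z"
    if r: "r \<in> carrier R" and z: "z \<in> ?S" for r z
  proof (rule pqI)
    have "r \<odot>\<^bsub>M\<^esub> z = r \<odot>\<^bsub>M\<^esub> (p z \<oplus>\<^bsub>M\<^esub> q z)" using pq(3)[OF z] by simp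
    then show "r \<odot>\<^bsub>M\<^esub> z = r \<odot>\<^bsub>M\<^esub> p z \<oplus>\<^bsub>M\<^esub> r \<odot>\<^bsub>M\<^esub> q z"
      using pq(1,2)[OF z] PM QM r by (simp add: smult_r_distr)
  qed (use submoduleD(4)[OF P] submoduleD(4)[OF Q] pq z r in auto)
  have "lifting_property R ?M A B" if A: "right_module R A" and B: "right_module R B"
    for A :: "('a, 'b \<Rightarrow> 'a) module" and B :: "('a, 'b) module"
    unfolding lifting_property_def
  proof (intro allI impI, elim conjE)
    fix f g
    assume f: "f \<in> right_module_hom R A B" and surj: "f ` carrier A = carrier B"
      and g: "g \<in> right_module_hom R ?M B"
    interpret A: right_module R A by fact
    interpret B: right_module R B by fact
    note g' = right_module_homD[OF g, simplified] and f' = right_module_homD[OF f]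
    have res: "g \<in> right_module_hom R (M\<lparr>carrier := H\<rparr>) B" if "H \<subseteq> ?S" for H
      using that g' by (intro right_module_homI) (auto simp: subset_iff)
    have lift: "\<exists>h\<in>right_module_hom R (M\<lparr>carrier := H\<rparr>) A. \<forall>x\<in>H. f (h x) = g x"
      if "projective_right_module R (M\<lparr>carrier := H\<rparr>)" "H \<subseteq> ?S" for H
    proof -
      have "lifting_property R (M\<lparr>carrier := H\<rparr>) A B"
        using that(1) A B unfolding projective_right_module_def by blast
      then have "\<exists>h\<in>right_module_hom R (M\<lparr>carrier := H\<rparr>) A.
          \<forall>x\<in>carrier (M\<lparr>carrier := H\<rparr>). f (h x) = g x"
        using f surj res[OF that(2)] unfolding lifting_property_def by blast
      then show ?thesis by simp
    qed
    obtain h where h: "h \<in> right_module_hom R (M\<lparr>carrier := P\<rparr>) A"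
      and fh: "\<And>x. x \<in> P \<Longrightarrow> f (h x) = g x" using lift[OF projP subs(1)] by blast
    obtain k where k: "k \<in> right_module_hom R (M\<lparr>carrier := Q\<rparr>) A"
      and fk: "\<And>x. x \<in> Q \<Longrightarrow> f (k x) = g x" using lift[OF projQ subs(2)] by blast
    note h' = right_module_homD[OF h, simplified] and k' = right_module_homD[OF k, simplified]
    let ?u = "\<lambda>z. h (p z) \<oplus>\<^bsub>A\<^esub> k (q z)"
    have "?u \<in> right_module_hom R ?M A"
      by (rule right_module_homI)
        (use pq(1,2) pq_add pq_smult h' k' in \<open>auto simp: A.M.a_ac A.smult_r_distr\<close>)
    moreover have "f (?u z) = g z" if z: "z \<in> ?S" for z
    proof -
      have "f (?u z) = g (p z) \<oplus>\<^bsub>B\<^esub> g (q z)"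
        using f'(2) h'(1) k'(1) fh fk pq(1,2)[OF z] by simp
      also have "\<dots> = g (p z \<oplus>\<^bsub>M\<^esub> q z)" using g'(2) pq(1,2)[OF z] subs by (simp add: subset_iff)
      also have "\<dots> = g z" using pq(3)[OF z] by simp
      finally show ?thesis .
    qed
    ultimately show "\<exists>h\<in>right_module_hom R ?M A. \<forall>x\<in>carrier ?M. f (h x) = g x"
      by (intro bexI[of _ ?u]) auto
  qed
  then show ?thesis using right_module_submodule[OF S] by (simp add: projective_right_module_def)
qed

text \<open>The three parts of a decomposition \<open>M = P \<oplus> Q \<oplus> L\<close> regrouped in the ways needed below:
  \<open>P \<oplus> Q\<close> is the enlarged projective part, while \<open>P + L\<close> is the submodule to which
  Nakayama's lemma is applied.\<close>

lemma internal_direct_sum_refine: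
  assumes PN: "internal_direct_sum R M P N"
    and QL: "internal_direct_sum R (M\<lparr>carrier := N\<rparr>) Q L"
  shows "P \<inter> Q = {\<zero>\<^bsub>M\<^esub>}" "internal_direct_sum R M (P <+>\<^bsub>M\<^esub> Q) L"
    and "(P <+>\<^bsub>M\<^esub> L) \<inter> Q = {\<zero>\<^bsub>M\<^esub>}"
proof -
  have P: "submodule P R M" and N: "submodule N R M" and sum: "P <+>\<^bsub>M\<^esub> N = carrier M"
    and int: "P \<inter> N = {\<zero>\<^bsub>M\<^esub>}"
    using PN by (auto simp: internal_direct_sum_def)
  have "submodule Q R (M\<lparr>carrier := N\<rparr>)" "submodule L R (M\<lparr>carrier := N\<rparr>)"
    and sum': "Q <+>\<^bsub>M\<^esub> L = N" and int': "Q \<inter> L = {\<zero>\<^bsub>M\<^esub>}"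
    using QL by (auto simp: internal_direct_sum_def set_add_defs)
  then have QN: "Q \<subseteq> N" and Q: "submodule Q R M" and LN: "L \<subseteq> N" and L: "submodule L R M"
    using submodule_of_submodule[OF N] by auto
  note zero = submoduleD(2)[OF P] submoduleD(2)[OF Q] submoduleD(2)[OF L]
  show "P \<inter> Q = {\<zero>\<^bsub>M\<^esub>}" using int QN zero by blast
  \<comment> \<open>Comparing the components in \<open>P\<close> and \<open>N\<close>; used once with \<open>Q\<close>, \<open>L\<close> and once with \<open>L\<close>, \<open>Q\<close>.\<close>
  have triple: "(P <+>\<^bsub>M\<^esub> A) \<inter> B = {\<zero>\<^bsub>M\<^esub>}"
    if A: "submodule A R M" "A \<subseteq> N" and B: "submodule B R M" "B \<subseteq> N" and AB: "A \<inter> B = {\<zero>\<^bsub>M\<^esub>}"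
    for A B
  proof -
    have "z = \<zero>\<^bsub>M\<^esub>" if z: "z \<in> P <+>\<^bsub>M\<^esub> A" "z \<in> B" for z
    proof -
      obtain p a where pa: "p \<in> P" "a \<in> A" "z = p \<oplus>\<^bsub>M\<^esub> a" using z(1) by (auto simp: mem_set_add_iff)
      have "z \<in> carrier M" using z(2) submoduleD(1)[OF B(1)] by blast
      then have "p \<oplus>\<^bsub>M\<^esub> a = \<zero>\<^bsub>M\<^esub> \<oplus>\<^bsub>M\<^esub> z" using pa(3) by simp
      then have "a = z"
        using direct_sum_unique(2)[OF P N int pa(1) submoduleD(2)[OF P]] pa(2) z(2) A(2) B(2)
        by blast
      then show ?thesis using pa(2) z(2) AB by blast
    qed
    then show ?thesis
      using submoduleD(2)[OF submodule_add[OF P A(1)]] submoduleD(2)[OF B(1)] by blast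
  qed
  show "(P <+>\<^bsub>M\<^esub> L) \<inter> Q = {\<zero>\<^bsub>M\<^esub>}" using triple[OF L LN Q QN] int' by blast
  have "submodule (P <+>\<^bsub>M\<^esub> Q) R M" by (rule submodule_add[OF P Q])
  moreover have "P <+>\<^bsub>M\<^esub> Q <+>\<^bsub>M\<^esub> L = carrier M"
    using M.add.set_mult_assoc[of P Q L] submoduleD(1)[OF P] submoduleD(1)[OF Q]
      submoduleD(1)[OF L] sum sum' by (simp add: set_add_def)
  ultimately show "internal_direct_sum R M (P <+>\<^bsub>M\<^esub> Q) L"
    using L triple[OF Q QN L LN int'] by (simp add: internal_direct_sum_def)
qed

text \<open>Splitting a nonzero \<open>Q\<close> off \<open>N\<close> strictly enlarges \<open>P + Rad M\<close>.  Otherwise \<open>P + L\<close> and \<open>Rad M\<close>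
  together contain \<open>P\<close>, \<open>Q\<close> and \<open>L\<close>, so \<open>P + L = M\<close> by Nakayama's lemma, although \<open>P + L\<close> meets
  \<open>Q\<close> trivially.\<close>

lemma summand_not_below_modulo_radical:
  assumes fg: "finitely_generated R M"
    and PN: "internal_direct_sum R M P N"
    and QL: "internal_direct_sum R (M\<lparr>carrier := N\<rparr>) Q L"
    and Q0: "Q \<noteq> {\<zero>\<^bsub>M\<^esub>}"
  shows "\<not> Q \<subseteq> P <+>\<^bsub>M\<^esub> module_radical R M"
proof
  let ?D = "module_radical R M"
  assume sub: "Q \<subseteq> P <+>\<^bsub>M\<^esub> ?D"
  note refine = internal_direct_sum_refine[OF PN QL]
  have P: "submodule P R M" using PN by (simp add: internal_direct_sum_def)
  have N: "submodule N R M" using PN by (simp add: internal_direct_sum_def)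
  have Q: "submodule Q R M"
    using submodule_of_submodule[OF N] QL by (simp add: internal_direct_sum_def)
  have L: "submodule L R M" and sum: "P <+>\<^bsub>M\<^esub> Q <+>\<^bsub>M\<^esub> L = carrier M"
    using refine(2) by (simp_all add: internal_direct_sum_def)
  note D = submodule_radical
  note X = submodule_add[OF P L]
  note Y = submodule_add[OF X D]
  have "P <+>\<^bsub>M\<^esub> ?D \<subseteq> P <+>\<^bsub>M\<^esub> L <+>\<^bsub>M\<^esub> ?D"
    using set_add_least[OF Y, of P ?D] subset_set_add[OF X D] subset_set_add[OF P L] by blast
  then have "P <+>\<^bsub>M\<^esub> Q \<subseteq> P <+>\<^bsub>M\<^esub> L <+>\<^bsub>M\<^esub> ?D"
    using set_add_least[OF Y, of P Q] sub subset_set_add[OF P D] by blast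
  moreover have "L \<subseteq> P <+>\<^bsub>M\<^esub> L <+>\<^bsub>M\<^esub> ?D"
    using subset_set_add[OF X D] subset_set_add[OF P L] by blast
  ultimately have "carrier M \<subseteq> P <+>\<^bsub>M\<^esub> L <+>\<^bsub>M\<^esub> ?D"
    using set_add_least[OF Y, of "P <+>\<^bsub>M\<^esub> Q" L] sum by blast
  then have "P <+>\<^bsub>M\<^esub> L = carrier M"
    using radical_superfluous[OF fg X] submoduleD(1)[OF Y] by blast
  then show False using refine(3) submoduleD(1)[OF Q] Q0 by blast
qed

end

section \<open>The decomposition\<close>

theorem corollary2p4:
  fixes R :: "('a, 'r) ring_scheme" and M :: "('a, 'b, 'm) module_scheme"
  assumes "semilocal_ring R"
    and "right_module R M"
    and "finitely_generated R M"
  shows "\<exists>P N. internal_direct_sum R M P N \<and>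
               projective_right_module R (M\<lparr>carrier := P\<rparr>) \<and>
               stable_right_module R (M\<lparr>carrier := N\<rparr>)"
proof -
  interpret right_module R M by fact
  let ?D = "module_radical R M"
  define proj where "proj P N \<longleftrightarrow> internal_direct_sum R M P N \<and>
      projective_right_module R (M\<lparr>carrier := P\<rparr>)" for P N
  define F where "F = {P <+>\<^bsub>M\<^esub> ?D | P. \<exists>N. proj P N}"
  have "{\<zero>\<^bsub>M\<^esub>} <+>\<^bsub>M\<^esub> carrier M = carrier M"
    using set_add_least[OF submodule_carrier, of "{\<zero>\<^bsub>M\<^esub>}" "carrier M"]
      subset_set_add(2)[OF submodule_zero submodule_carrier] by blast
  then have "proj {\<zero>\<^bsub>M\<^esub>} (carrier M)"
    using projective_zero submodule_zero submodule_carrier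
    by (simp add: proj_def internal_direct_sum_def)
  then have ne: "F \<noteq> {}" by (auto simp: F_def)
  have sub: "submodule L R M \<and> ?D \<subseteq> L" if "L \<in> F" for L
    using that submodule_add[OF _ submodule_radical] subset_set_add(2)[OF _ submodule_radical]
    by (auto simp: F_def proj_def internal_direct_sum_def)
  have "\<exists>U\<in>F. \<forall>L\<in>F. U \<subseteq> L \<longrightarrow> L = U"
    by (rule noetherian_over_maximal[OF noetherian_over_radical[OF assms(1,3)] ne sub])
  then obtain U where U: "U \<in> F" and max: "\<And>L. \<lbrakk> L \<in> F; U \<subseteq> L \<rbrakk> \<Longrightarrow> L = U"
    by blast
  from U obtain P N where UP: "U = P <+>\<^bsub>M\<^esub> ?D" and PN: "internal_direct_sum R M P N"
    and projP: "projective_right_module R (M\<lparr>carrier := P\<rparr>)" by (auto simp: F_def proj_def)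
  have P: "submodule P R M" and N: "submodule N R M"
    using PN by (simp_all add: internal_direct_sum_def)
  have "stable_right_module R (M\<lparr>carrier := N\<rparr>)"
    unfolding stable_right_module_def
  proof (intro conjI notI, rule right_module_submodule[OF N], elim exE conjE)
    fix Q L
    assume QL: "internal_direct_sum R (M\<lparr>carrier := N\<rparr>) Q L"
      and "Q \<noteq> {\<zero>\<^bsub>M\<lparr>carrier := N\<rparr>\<^esub>}"
      and "projective_right_module R (M\<lparr>carrier := N, carrier := Q\<rparr>)"
    then have Q0: "Q \<noteq> {\<zero>\<^bsub>M\<^esub>}" and projQ: "projective_right_module R (M\<lparr>carrier := Q\<rparr>)"
      by simp_all
    have Q: "submodule Q R M"
      using submodule_of_submodule[OF N] QL by (simp add: internal_direct_sum_def)
    note refine = internal_direct_sum_refine[OF PN QL]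
    note S = submodule_add[OF P Q]
    note V = submodule_add[OF S submodule_radical]
    let ?V = "P <+>\<^bsub>M\<^esub> Q <+>\<^bsub>M\<^esub> ?D"
    have "proj (P <+>\<^bsub>M\<^esub> Q) L"
      using refine(2) projective_add[OF P Q refine(1) projP projQ] by (simp add: proj_def)
    then have "?V \<in> F" by (auto simp: F_def)
    moreover have "U \<subseteq> ?V"
      unfolding UP using subset_set_add[OF P Q] subset_set_add[OF S submodule_radical]
      by (intro set_add_least[OF V]) auto
    ultimately have "?V = U" by (rule max)
    then have "Q \<subseteq> P <+>\<^bsub>M\<^esub> ?D"
      using subset_set_add(2)[OF P Q] subset_set_add(1)[OF S submodule_radical] UP by blast
    then show False
      using summand_not_below_modulo_radical[OF assms(3) PN QL Q0] by blast
  qed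
  then show ?thesis using PN projP by blast
qed

end
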